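(* Let $G$ be a finite group, $x\in G$ an element of prime order $p$, and suppose that $|G|>2p$. Let $\Gamma=G\ast_{\langle x\rangle}G$ be the amalgamated product in which $\langle x\rangle$ is embedded in both copies of $G$ in the same way. Denote by $[x]$ the conjugacy class of $x$ in $G$. Then $$\mu(\Gamma)=\frac1p+\max_{H\leq G}\left(\frac{|[x]\cap H|\,(p-1)}{|[x]|\,p}-\frac{2}{(G:H)}\right),$$ where the maximum is taken over all subgroups $H$ of $G$.
   Context: For a finitely generated group $\Gamma$, $s_n(\Gamma)$ denotes the number of subgroups of index $n$ in $\Gamma$, and the growth coefficient of $\Gamma$ is $$\mu(\Gamma)=\limsup_{n\to\infty}\frac{\log s_n(\Gamma)}{n\log n}.$$ $(G:H)$ denotes the index of $H$ in $G$. *)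

theory Defs
  imports
    "HOL-Analysis.Extended_Real_Limits"
    "HOL-Computational_Algebra.Primes"
    "HOL-Algebra.Elementary_Groups"
    "HOL-Algebra.Multiplicative_Group"
begin

text \<open>
  Elements of the amalgamated product of \<open>G\<close> and \<open>H\<close> over \<open>A\<close>, embedded by \<open>f\<close> in \<open>G\<close> and
  by \<open>g\<close> in \<open>H\<close>, are classes of words in the disjoint union of \<open>G\<close> and \<open>H\<close> modulo the least
  congruence of the free monoid that contains the multiplication tables of both groups and
  identifies the two images of each element of \<open>A\<close>.
\<close>

definition amalg_words :: "('a, 'm) monoid_scheme \<Rightarrow> ('b, 'n) monoid_scheme \<Rightarrow> ('a + 'b) list set"
  where "amalg_words G H = lists (Inl ` carrier G \<union> Inr ` carrier H)"

inductive_set amalg_cong ::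
  "('a, 'm) monoid_scheme \<Rightarrow> ('b, 'n) monoid_scheme \<Rightarrow> ('c, 'k) monoid_scheme
    \<Rightarrow> ('c \<Rightarrow> 'a) \<Rightarrow> ('c \<Rightarrow> 'b) \<Rightarrow> (('a + 'b) list \<times> ('a + 'b) list) set"
  for G and H and A and f and g
where
  refl: "w \<in> amalg_words G H \<Longrightarrow> (w, w) \<in> amalg_cong G H A f g"
| sym: "(v, w) \<in> amalg_cong G H A f g \<Longrightarrow> (w, v) \<in> amalg_cong G H A f g"
| trans: "(u, v) \<in> amalg_cong G H A f g \<Longrightarrow> (v, w) \<in> amalg_cong G H A f g
    \<Longrightarrow> (u, w) \<in> amalg_cong G H A f g"
| append: "(u, u') \<in> amalg_cong G H A f g \<Longrightarrow> (v, v') \<in> amalg_cong G H A f g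
    \<Longrightarrow> (u @ v, u' @ v') \<in> amalg_cong G H A f g"
| one_left: "([Inl \<one>\<^bsub>G\<^esub>], []) \<in> amalg_cong G H A f g"
| one_right: "([Inr \<one>\<^bsub>H\<^esub>], []) \<in> amalg_cong G H A f g"
| mult_left: "x \<in> carrier G \<Longrightarrow> y \<in> carrier G
    \<Longrightarrow> ([Inl x, Inl y], [Inl (x \<otimes>\<^bsub>G\<^esub> y)]) \<in> amalg_cong G H A f g"
| mult_right: "x \<in> carrier H \<Longrightarrow> y \<in> carrier H
    \<Longrightarrow> ([Inr x, Inr y], [Inr (x \<otimes>\<^bsub>H\<^esub> y)]) \<in> amalg_cong G H A f g"
| glue: "a \<in> carrier A \<Longrightarrow> ([Inl (f a)], [Inr (g a)]) \<in> amalg_cong G H A f g"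

definition amalgamated_product ::
  "('a, 'm) monoid_scheme \<Rightarrow> ('b, 'n) monoid_scheme \<Rightarrow> ('c, 'k) monoid_scheme
    \<Rightarrow> ('c \<Rightarrow> 'a) \<Rightarrow> ('c \<Rightarrow> 'b) \<Rightarrow> ('a + 'b) list set monoid"
  where "amalgamated_product G H A f g =
    \<lparr>carrier = amalg_words G H // amalg_cong G H A f g,
     mult = (\<lambda>U V. \<Union>u\<in>U. \<Union>v\<in>V. amalg_cong G H A f g `` {u @ v}),
     one = amalg_cong G H A f g `` {[]}\<rparr>"

definition amalg_inl ::
  "('a, 'm) monoid_scheme \<Rightarrow> ('b, 'n) monoid_scheme \<Rightarrow> ('c, 'k) monoid_scheme
    \<Rightarrow> ('c \<Rightarrow> 'a) \<Rightarrow> ('c \<Rightarrow> 'b) \<Rightarrow> 'a \<Rightarrow> ('a + 'b) list set"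
  where "amalg_inl G H A f g x = amalg_cong G H A f g `` {[Inl x]}"

definition amalg_inr ::
  "('a, 'm) monoid_scheme \<Rightarrow> ('b, 'n) monoid_scheme \<Rightarrow> ('c, 'k) monoid_scheme
    \<Rightarrow> ('c \<Rightarrow> 'a) \<Rightarrow> ('c \<Rightarrow> 'b) \<Rightarrow> 'b \<Rightarrow> ('a + 'b) list set"
  where "amalg_inr G H A f g y = amalg_cong G H A f g `` {[Inr y]}"

locale amalgam =
  G: group G + H: group H + A: group A
  for G :: "('a, 'm) monoid_scheme" and H :: "('b, 'n) monoid_scheme"
    and A :: "('c, 'k) monoid_scheme" +
  fixes f :: "'c \<Rightarrow> 'a" and g :: "'c \<Rightarrow> 'b"
  assumes f_hom: "f \<in> hom A G" and g_hom: "g \<in> hom A H"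
begin

abbreviation "W \<equiv> amalg_words G H"
abbreviation "R \<equiv> amalg_cong G H A f g"
abbreviation "P \<equiv> amalgamated_product G H A f g"

lemma cong_words: "(u, v) \<in> R \<Longrightarrow> u \<in> W \<and> v \<in> W"
  by (induction rule: amalg_cong.induct)
     (use f_hom g_hom in \<open>auto simp: amalg_words_def hom_def Pi_def\<close>)

lemma equiv_cong: "equiv W R"
proof (rule equivI)
  show "R \<subseteq> W \<times> W" using cong_words by auto
  show "refl_on W R"
    by (auto simp: refl_on_def intro: amalg_cong.refl)
  show "sym R" by (meson amalg_cong.sym symI)
  show "trans R" by (meson amalg_cong.trans transI)
qed

lemma append_words: "u \<in> W \<Longrightarrow> v \<in> W \<Longrightarrow> u @ v \<in> W"
  by (auto simp: amalg_words_def)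

lemma carrier_P: "carrier P = W // R"
  by (simp add: amalgamated_product_def)

lemma class_in_carrier: "w \<in> W \<Longrightarrow> R `` {w} \<in> carrier P"
  by (simp add: carrier_P quotientI)

lemma one_P: "\<one>\<^bsub>P\<^esub> = R `` {[]}"
  by (simp add: amalgamated_product_def)

lemma mult_class:
  assumes "u \<in> W" "v \<in> W"
  shows "R `` {u} \<otimes>\<^bsub>P\<^esub> R `` {v} = R `` {u @ v}"
proof -
  have "R `` {u' @ v'} = R `` {u @ v}" if "(u, u') \<in> R" "(v, v') \<in> R" for u' v'
    using equiv_class_eq[OF equiv_cong amalg_cong.append[OF that]] by (rule HOL.sym)
  then have "(\<Union>u'\<in>R `` {u}. \<Union>v'\<in>R `` {v}. R `` {u' @ v'}) =
      (\<Union>u'\<in>R `` {u}. \<Union>v'\<in>R `` {v}. R `` {u @ v})"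
    by (intro SUP_cong HOL.refl) simp
  also have "\<dots> = R `` {u @ v}"
    using amalg_cong.refl[OF assms(1), of A f g] amalg_cong.refl[OF assms(2), of A f g] by blast
  finally show ?thesis by (simp add: amalgamated_product_def)
qed

lemma carrier_cases:
  assumes "X \<in> carrier P" obtains w where "w \<in> W" "X = R `` {w}"
  using assms by (auto simp: carrier_P elim: quotientE)

lemma nil_word: "[] \<in> W" by (simp add: amalg_words_def)

lemma inl_word: "x \<in> carrier G \<Longrightarrow> [Inl x] \<in> W"
  and inr_word: "y \<in> carrier H \<Longrightarrow> [Inr y] \<in> W"
  by (auto simp: amalg_words_def)

lemma class_eq: "(u, v) \<in> R \<Longrightarrow> R `` {u} = R `` {v}"
  by (rule equiv_class_eq[OF equiv_cong])

lemma left_inverse_word: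
  assumes "w \<in> W" shows "\<exists>v\<in>W. (v @ w, []) \<in> R"
proof -
  have "w \<in> lists (Inl ` carrier G \<union> Inr ` carrier H)" using assms by (simp add: amalg_words_def)
  then show ?thesis
  proof (induction w)
    case Nil
    have "([] @ [], []) \<in> R" using nil_word by (simp add: amalg_cong.refl)
    then show ?case using nil_word by (rule bexI)
  next
    case (Cons z w)
    then obtain v where v: "v \<in> W" "(v @ w, []) \<in> R" by blast
    have w: "w \<in> W" using Cons by (simp add: amalg_words_def)
    obtain z' where z': "[z'] \<in> W" "([z', z], []) \<in> R"
    proof (cases z)
      case (Inl x)
      then have "x \<in> carrier G" using Cons by auto
      have "([Inl (inv\<^bsub>G\<^esub> x), Inl x], [Inl \<one>\<^bsub>G\<^esub>]) \<in> R"
        using amalg_cong.mult_left[of "inv\<^bsub>G\<^esub> x" G x] \<open>x \<in> carrier G\<close> by fastforce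
      then have "([Inl (inv\<^bsub>G\<^esub> x), Inl x], []) \<in> R"
        by (rule amalg_cong.trans[OF _ amalg_cong.one_left])
      then show thesis using that[of "Inl (inv\<^bsub>G\<^esub> x)"] Inl \<open>x \<in> carrier G\<close> inl_word by simp
    next
      case (Inr x)
      then have "x \<in> carrier H" using Cons by auto
      have "([Inr (inv\<^bsub>H\<^esub> x), Inr x], [Inr \<one>\<^bsub>H\<^esub>]) \<in> R"
        using amalg_cong.mult_right[of "inv\<^bsub>H\<^esub> x" H x] \<open>x \<in> carrier H\<close> by fastforce
      then have "([Inr (inv\<^bsub>H\<^esub> x), Inr x], []) \<in> R"
        by (rule amalg_cong.trans[OF _ amalg_cong.one_right])
      then show thesis using that[of "Inr (inv\<^bsub>H\<^esub> x)"] Inr \<open>x \<in> carrier H\<close> inr_word by simp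
    qed
    have "(v @ ([z', z] @ w), v @ ([] @ w)) \<in> R"
      by (rule amalg_cong.append[OF amalg_cong.refl[OF v(1)]
            amalg_cong.append[OF z'(2) amalg_cong.refl[OF w]]])
    then have "((v @ [z']) @ (z # w), []) \<in> R"
      using amalg_cong.trans[OF _ v(2), of "v @ [z', z] @ w"] by simp
    with append_words[OF v(1) z'(1)] show ?case by (rule bexI[rotated])
  qed
qed

theorem group_amalgamated_product: "group P"
proof (rule groupI)
  fix X Y assume "X \<in> carrier P" "Y \<in> carrier P"
  then show "X \<otimes>\<^bsub>P\<^esub> Y \<in> carrier P"
    by (elim carrier_cases) (simp add: mult_class append_words class_in_carrier)
next
  show "\<one>\<^bsub>P\<^esub> \<in> carrier P" by (simp add: one_P nil_word class_in_carrier)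
next
  fix X Y Z assume "X \<in> carrier P" "Y \<in> carrier P" "Z \<in> carrier P"
  then show "X \<otimes>\<^bsub>P\<^esub> Y \<otimes>\<^bsub>P\<^esub> Z = X \<otimes>\<^bsub>P\<^esub> (Y \<otimes>\<^bsub>P\<^esub> Z)"
    by (elim carrier_cases) (simp add: mult_class append_words)
next
  fix X assume "X \<in> carrier P"
  then show "\<one>\<^bsub>P\<^esub> \<otimes>\<^bsub>P\<^esub> X = X"
    by (elim carrier_cases) (simp add: one_P mult_class nil_word)
next
  fix X assume "X \<in> carrier P"
  then obtain w where w: "w \<in> W" "X = R `` {w}" by (rule carrier_cases)
  then obtain v where "v \<in> W" "(v @ w, []) \<in> R" using left_inverse_word by blast
  then have "R `` {v} \<in> carrier P" "R `` {v} \<otimes>\<^bsub>P\<^esub> X = \<one>\<^bsub>P\<^esub>"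
    using w by (simp_all only: class_in_carrier mult_class one_P class_eq[of "v @ w" "[]"])
  then show "\<exists>Y\<in>carrier P. Y \<otimes>\<^bsub>P\<^esub> X = \<one>\<^bsub>P\<^esub>" by blast
qed

lemma inl_hom: "amalg_inl G H A f g \<in> hom G P"
proof (rule homI)
  fix x y assume "x \<in> carrier G" "y \<in> carrier G"
  then show "amalg_inl G H A f g (x \<otimes>\<^bsub>G\<^esub> y) =
      amalg_inl G H A f g x \<otimes>\<^bsub>P\<^esub> amalg_inl G H A f g y"
    by (simp add: amalg_inl_def inl_word mult_class class_eq[OF amalg_cong.mult_left])
qed (simp add: amalg_inl_def class_in_carrier inl_word)

lemma inr_hom: "amalg_inr G H A f g \<in> hom H P"
proof (rule homI)
  fix x y assume "x \<in> carrier H" "y \<in> carrier H"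
  then show "amalg_inr G H A f g (x \<otimes>\<^bsub>H\<^esub> y) =
      amalg_inr G H A f g x \<otimes>\<^bsub>P\<^esub> amalg_inr G H A f g y"
    by (simp add: amalg_inr_def inr_word mult_class class_eq[OF amalg_cong.mult_right])
qed (simp add: amalg_inr_def class_in_carrier inr_word)

lemma inl_inr_glue: "a \<in> carrier A \<Longrightarrow> amalg_inl G H A f g (f a) = amalg_inr G H A f g (g a)"
  unfolding amalg_inl_def amalg_inr_def by (intro class_eq amalg_cong.glue)

theorem universal_property_existence:
  assumes K: "group K" and h: "h \<in> hom G K" and k: "k \<in> hom H K"
    and hk: "\<And>a. a \<in> carrier A \<Longrightarrow> h (f a) = k (g a)"
  shows "\<exists>\<phi>\<in>hom P K. (\<forall>x\<in>carrier G. \<phi> (amalg_inl G H A f g x) = h x) \<and>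
                    (\<forall>y\<in>carrier H. \<phi> (amalg_inr G H A f g y) = k y)"
proof -
  interpret K: group K by (rule K)
  define e where "e w = foldr (\<lambda>z r. case_sum h k z \<otimes>\<^bsub>K\<^esub> r) w \<one>\<^bsub>K\<^esub>" for w
  have e_simps: "e [] = \<one>\<^bsub>K\<^esub>" "e (z # w) = case_sum h k z \<otimes>\<^bsub>K\<^esub> e w" for z w
    by (simp_all add: e_def)
  have hc: "x \<in> carrier G \<Longrightarrow> h x \<in> carrier K" and kc: "y \<in> carrier H \<Longrightarrow> k y \<in> carrier K" for x y
    using h k by (auto simp: hom_def)
  have ec: "e w \<in> carrier K" if "w \<in> W" for w
    using that unfolding amalg_words_def
    by (induction w) (auto simp: e_simps hc kc)
  have ea: "e (v @ w) = e v \<otimes>\<^bsub>K\<^esub> e w" if "v \<in> W" "w \<in> W" for v w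
    using that(1) unfolding amalg_words_def
  proof (induction v)
    case Nil
    then show ?case using ec that by (simp add: e_simps)
  next
    case (Cons z v)
    then have "e v \<in> carrier K" using ec by (simp add: amalg_words_def)
    then show ?case using Cons ec[OF that(2)] by (auto simp: e_simps hc kc K.m_assoc)
  qed
  have er: "e v = e w" if "(v, w) \<in> R" for v w
    using that
  proof (induction rule: amalg_cong.induct)
    case (append u u' v v')
    then show ?case using ea cong_words by metis
  next
    case one_left
    then show ?case using hom_one[OF h G.group_axioms K] by (simp add: e_simps)
  next
    case one_right
    then show ?case using hom_one[OF k H.group_axioms K] by (simp add: e_simps)
  next
    case (mult_left x y)
    then show ?case using h by (simp add: e_simps hom_mult hc)
  next
    case (mult_right x y)
    then show ?case using k by (simp add: e_simps hom_mult kc)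
  next
    case (glue a)
    then show ?case by (simp add: e_simps hk)
  qed auto
  define \<phi> where "\<phi> X = e (SOME w. w \<in> X)" for X
  have \<phi>: "\<phi> (R `` {w}) = e w" if "w \<in> W" for w
  proof -
    have "w \<in> R `` {w}" using that amalg_cong.refl by blast
    then have "(SOME v. v \<in> R `` {w}) \<in> R `` {w}" by (rule someI)
    then show ?thesis unfolding \<phi>_def using er by (metis Image_singleton_iff)
  qed
  show ?thesis
  proof (intro bexI[of _ \<phi>] conjI ballI)
    show "\<phi> \<in> hom P K"
      by (rule homI; elim carrier_cases) (simp_all add: mult_class \<phi> ec ea append_words)
  qed (simp_all add: amalg_inl_def amalg_inr_def \<phi> inl_word inr_word e_simps hc kc)
qed

end


definition subgroups_of_index :: "('a, 'm) monoid_scheme \<Rightarrow> nat \<Rightarrow> 'a set set"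
  where "subgroups_of_index G n =
    {H. subgroup H G \<and> finite (rcosets\<^bsub>G\<^esub> H) \<and> card (rcosets\<^bsub>G\<^esub> H) = n}"

definition num_subgroups :: "('a, 'm) monoid_scheme \<Rightarrow> nat \<Rightarrow> nat"
  where "num_subgroups G n = card (subgroups_of_index G n)"

text \<open>
  The convention \<open>log 0 = -\<infinity>\<close> is spelled out, since \<open>ln 0 = 0\<close> for real \<open>ln\<close>, and a group may have
  no subgroup of index \<open>n\<close>.  The values at \<open>n \<le> 1\<close>, where the denominator vanishes, are irrelevant
  to the upper limit.
\<close>

definition growth_coefficient :: "('a, 'm) monoid_scheme \<Rightarrow> ereal"
  where "growth_coefficient G = limsup (\<lambda>n.
    if num_subgroups G n = 0 then -\<infinity>
    else ereal (ln (real (num_subgroups G n)) / (real n * ln (real n))))"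

definition conjugacy_class :: "('a, 'm) monoid_scheme \<Rightarrow> 'a \<Rightarrow> 'a set"
  where "conjugacy_class G x = {g \<otimes>\<^bsub>G\<^esub> x \<otimes>\<^bsub>G\<^esub> inv\<^bsub>G\<^esub> g | g. g \<in> carrier G}"

end

theory Submission
  imports Defs "HOL-Combinatorics.Permutations" "HOL-Analysis.Convex"
begin

text \<open>
  An action of \<open>\<Gamma>\<close> on \<open>n\<close> points is a pair of actions of \<open>G\<close> that agree on \<open>\<langle>x\<rangle>\<close>.  Up to factors
  exponential in \<open>n\<close>, which do not influence \<open>\<mu>\<close>, the actions of a finite group with \<open>a\<close> orbits
  that extend a given action with \<open>q\<close> orbits of a subgroup number at most \<open>n\<^sup>q / n\<^sup>a\<close>: it suffices
  to name the root of the orbit of each of the \<open>q\<close> subgroup orbits.  There are hence at most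
  \<open>n\<^sup>n / n\<^sup>q\<close> choices for the action of \<open>\<langle>x\<rangle>\<close> and then \<open>n\<^sup>q / n\<^sup>a\<close> choices for each copy of \<open>G\<close>.
  As \<open>x\<close> fixes the proportion \<open>|[x] \<inter> H| / |[x]|\<close> of a \<open>G\<close>-orbit with stabiliser \<open>H\<close>, the number
  \<open>q - 2a\<close> is at most \<open>\<mu>n\<close>, and it equals \<open>\<mu>n\<close> for copies of \<open>G/H\<close> with \<open>H\<close> optimal.  In that case
  the Cauchy-Schwarz inequality shows that the conjugates of this one action already produce
  sufficiently many pairs.  Finally, a subgroup of index \<open>n\<close> corresponds to \<open>(n - 1)!\<close> transitive
  actions.  Since \<open>|G| > 2p\<close> makes \<open>\<mu>\<close> positive (take \<open>H = 1\<close>), intransitive actions do not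
  contribute to the exponential rate: if all \<open>s\<^sub>k\<close> grew more slowly, then so would the number of all
  actions, by the recurrence that splits off the orbit of one point.
\<close>

section \<open>Right actions\<close>

text \<open>Right actions fit the right cosets \<open>rcosets\<close> by which the index is
  measured. The extensional function spaces make the set of actions finite for finite
  \<open>G\<close> and \<open>S\<close>, and make an action determined by its values on
  \<open>carrier G\<close> and \<open>S\<close>.\<close>

definition right_actions :: "('g, 'm) monoid_scheme \<Rightarrow> 's set \<Rightarrow> ('g \<Rightarrow> 's \<Rightarrow> 's) set"
  where "right_actions G S = {\<phi> \<in> carrier G \<rightarrow>\<^sub>E (S \<rightarrow>\<^sub>E S).
    (\<forall>s\<in>S. \<phi> \<one>\<^bsub>G\<^esub> s = s) \<and>
    (\<forall>g\<in>carrier G. \<forall>h\<in>carrier G. \<forall>s\<in>S. \<phi> (g \<otimes>\<^bsub>G\<^esub> h) s = \<phi> h (\<phi> g s))}"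

definition orbit :: "('g, 'm) monoid_scheme \<Rightarrow> ('g \<Rightarrow> 's \<Rightarrow> 's) \<Rightarrow> 's \<Rightarrow> 's set"
  where "orbit G \<phi> s = (\<lambda>g. \<phi> g s) ` carrier G"

definition stab :: "('g, 'm) monoid_scheme \<Rightarrow> ('g \<Rightarrow> 's \<Rightarrow> 's) \<Rightarrow> 's \<Rightarrow> 'g set"
  where "stab G \<phi> s = {g \<in> carrier G. \<phi> g s = s}"

text \<open>The action for which \<open>b\<close> becomes an isomorphism of \<open>G\<close>-sets.
  For \<open>S = T\<close> this is conjugation by a permutation of \<open>S\<close>.\<close>

definition transport ::
  "('g, 'm) monoid_scheme \<Rightarrow> 's set \<Rightarrow> 't set \<Rightarrow> ('s \<Rightarrow> 't) \<Rightarrow> ('g \<Rightarrow> 's \<Rightarrow> 's) \<Rightarrow> 'g \<Rightarrow> 't \<Rightarrow> 't"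
  where "transport G S T b \<phi> =
    (\<lambda>g\<in>carrier G. \<lambda>t\<in>T. b (\<phi> g (inv_into S b t)))"

definition coset_action :: "('g, 'm) monoid_scheme \<Rightarrow> 'g set \<Rightarrow> 'g \<Rightarrow> 'g set \<Rightarrow> 'g set"
  where "coset_action G K = (\<lambda>g\<in>carrier G. \<lambda>C\<in>rcosets\<^bsub>G\<^esub> K. C #>\<^bsub>G\<^esub> g)"

lemma right_actionsI:
  assumes "\<phi> \<in> extensional (carrier G)"
    and "\<And>g. g \<in> carrier G \<Longrightarrow> \<phi> g \<in> extensional S"
    and "\<And>g s. g \<in> carrier G \<Longrightarrow> s \<in> S \<Longrightarrow> \<phi> g s \<in> S"
    and "\<And>s. s \<in> S \<Longrightarrow> \<phi> \<one>\<^bsub>G\<^esub> s = s"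
    and "\<And>g h s. g \<in> carrier G \<Longrightarrow> h \<in> carrier G \<Longrightarrow> s \<in> S \<Longrightarrow> \<phi> (g \<otimes>\<^bsub>G\<^esub> h) s = \<phi> h (\<phi> g s)"
  shows "\<phi> \<in> right_actions G S"
  using assms by (auto simp: right_actions_def PiE_def)

lemma right_actions_eqI:
  assumes "\<phi> \<in> right_actions G S" "\<psi> \<in> right_actions G S"
    and "\<And>g s. g \<in> carrier G \<Longrightarrow> s \<in> S \<Longrightarrow> \<phi> g s = \<psi> g s"
  shows "\<phi> = \<psi>"
proof (rule PiE_ext)
  show "\<phi> \<in> carrier G \<rightarrow>\<^sub>E (S \<rightarrow>\<^sub>E S)" "\<psi> \<in> carrier G \<rightarrow>\<^sub>E (S \<rightarrow>\<^sub>E S)"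
    using assms(1,2) by (auto simp: right_actions_def)
  fix g assume "g \<in> carrier G"
  show "\<phi> g = \<psi> g"
    by (rule PiE_ext[of _ S "\<lambda>_. S" _])
       (use assms \<open>g \<in> carrier G\<close> in \<open>auto simp: right_actions_def\<close>)
qed

lemma finite_right_actions:
  "finite (carrier G) \<Longrightarrow> finite S \<Longrightarrow> finite (right_actions G S)"
  by (rule finite_subset[of _ "carrier G \<rightarrow>\<^sub>E (S \<rightarrow>\<^sub>E S)"])
     (auto simp: right_actions_def intro!: finite_PiE)

lemma right_action_closed:
  "\<phi> \<in> right_actions G S \<Longrightarrow> g \<in> carrier G \<Longrightarrow> s \<in> S \<Longrightarrow> \<phi> g s \<in> S"
  by (auto simp: right_actions_def PiE_def Pi_def)

lemma right_action_one: "\<phi> \<in> right_actions G S \<Longrightarrow> s \<in> S \<Longrightarrow> \<phi> \<one>\<^bsub>G\<^esub> s = s"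
  by (simp add: right_actions_def)

lemma right_action_mult:
  "\<phi> \<in> right_actions G S \<Longrightarrow> g \<in> carrier G \<Longrightarrow> h \<in> carrier G \<Longrightarrow> s \<in> S \<Longrightarrow>
    \<phi> (g \<otimes>\<^bsub>G\<^esub> h) s = \<phi> h (\<phi> g s)"
  by (simp add: right_actions_def)

lemma transport_action:
  assumes b: "bij_betw b S T" and \<phi>: "\<phi> \<in> right_actions G S" and G: "group G"
  shows "transport G S T b \<phi> \<in> right_actions G T"
proof -
  interpret group G by (rule G)
  have iT: "inv_into S b t \<in> S" "b (inv_into S b t) = t" if "t \<in> T" for t
    using that b by (auto simp: bij_betw_def inv_into_into f_inv_into_f)
  have bS: "b s \<in> T" "inv_into S b (b s) = s" if "s \<in> S" for s
    using that b by (auto simp: bij_betw_def)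
  show ?thesis
    by (rule right_actionsI)
       (auto simp: transport_def iT bS right_action_closed[OF \<phi>] right_action_one[OF \<phi>]
          right_action_mult[OF \<phi>])
qed

lemma transport_apply:
  assumes "bij_betw b S T" "\<phi> \<in> right_actions G S" "g \<in> carrier G" "s \<in> S"
  shows "transport G S T b \<phi> g (b s) = b (\<phi> g s)"
  using assms by (auto simp: transport_def bij_betw_def)

text \<open>Transport along \<open>b\<close> is injective. This lets complements of orbits and
  products be replaced by the standard sets \<open>{..<k}\<close>.\<close>

lemma card_right_actions_le:
  assumes b: "bij_betw b S T" and G: "group G" and fin: "finite (right_actions G T)"
  shows "card (right_actions G S) \<le> card (right_actions G T)"
proof (rule card_inj_on_le[OF _ _ fin])
  show "inj_on (transport G S T b) (right_actions G S)"
  proof (rule inj_onI)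
    fix \<phi> \<psi> assume \<phi>: "\<phi> \<in> right_actions G S" and \<psi>: "\<psi> \<in> right_actions G S"
      and eq: "transport G S T b \<phi> = transport G S T b \<psi>"
    show "\<phi> = \<psi>"
    proof (rule right_actions_eqI[OF \<phi> \<psi>])
      fix g s assume "g \<in> carrier G" "s \<in> S"
      then show "\<phi> g s = \<psi> g s"
        using transport_apply[OF b \<phi>] transport_apply[OF b \<psi>] eq b
          right_action_closed[OF \<phi>] right_action_closed[OF \<psi>]
        by (metis bij_betw_imp_inj_on inj_onD)
    qed
  qed
qed (use transport_action[OF b _ G] in auto)

section \<open>Orbits, stabilisers and cosets\<close>

context group
begin

lemma right_action_inv:
  assumes "\<phi> \<in> right_actions G S" "g \<in> carrier G" "s \<in> S"
  shows "\<phi> (inv g) (\<phi> g s) = s" "\<phi> g (\<phi> (inv g) s) = s"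
  using right_action_mult[OF assms(1), of g "inv g" s] right_action_mult[OF assms(1), of "inv g" g s]
    right_action_one[OF assms(1)] assms by auto

lemma orbit_refl: "\<phi> \<in> right_actions G S \<Longrightarrow> s \<in> S \<Longrightarrow> s \<in> orbit G \<phi> s"
  using right_action_one[of \<phi> G S s] unfolding orbit_def by (metis imageI one_closed)

lemma orbit_subset: "\<phi> \<in> right_actions G S \<Longrightarrow> s \<in> S \<Longrightarrow> orbit G \<phi> s \<subseteq> S"
  using right_action_closed unfolding orbit_def by fast

lemma orbit_eq:
  assumes \<phi>: "\<phi> \<in> right_actions G S" and s: "s \<in> S" and t: "t \<in> orbit G \<phi> s"
  shows "orbit G \<phi> t = orbit G \<phi> s"
proof -
  obtain g where g: "g \<in> carrier G" "t = \<phi> g s" using t by (auto simp: orbit_def)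
  have 1: "\<phi> h t = \<phi> (g \<otimes> h) s" if "h \<in> carrier G" for h
    using that g right_action_mult[OF \<phi> _ _ s] by simp
  have "\<phi> (inv g \<otimes> h) t = \<phi> h s" if "h \<in> carrier G" for h
    using that g 1[of "inv g \<otimes> h"] by (simp add: m_assoc[symmetric])
  then have 2: "\<phi> h s = \<phi> (inv g \<otimes> h) t" if "h \<in> carrier G" for h
    using that by simp
  show ?thesis
  proof
    show "orbit G \<phi> t \<subseteq> orbit G \<phi> s" using 1 g(1) by (auto simp: orbit_def)
    show "orbit G \<phi> s \<subseteq> orbit G \<phi> t"
    proof
      fix u assume "u \<in> orbit G \<phi> s"
      then obtain h where "h \<in> carrier G" "u = \<phi> h s" by (auto simp: orbit_def)
      then show "u \<in> orbit G \<phi> t" using 2 g(1) unfolding orbit_def by blast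
    qed
  qed
qed

lemma orbit_eq_iff:
  assumes "\<phi> \<in> right_actions G S" "s \<in> S" "t \<in> S"
  shows "t \<in> orbit G \<phi> s \<longleftrightarrow> orbit G \<phi> t = orbit G \<phi> s"
  using assms orbit_eq orbit_refl by metis

text \<open>The orbits partition \<open>S\<close> and hence every subset of it. The cases of
  interest are \<open>B = S\<close> and \<open>B\<close> a set of fixed points.\<close>

lemma sum_card_orbits:
  assumes \<phi>: "\<phi> \<in> right_actions G S" and fin: "finite S" and B: "B \<subseteq> S"
  shows "(\<Sum>X\<in>orbit G \<phi> ` S. card (X \<inter> B)) = card B"
proof -
  have "card (\<Union>X\<in>orbit G \<phi> ` S. X \<inter> B) = (\<Sum>X\<in>orbit G \<phi> ` S. card (X \<inter> B))"
  proof (rule card_UN_disjoint)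
    show "\<forall>X\<in>orbit G \<phi> ` S. finite (X \<inter> B)" using B fin finite_subset by blast
    show "\<forall>X\<in>orbit G \<phi> ` S. \<forall>Y\<in>orbit G \<phi> ` S. X \<noteq> Y \<longrightarrow> X \<inter> B \<inter> (Y \<inter> B) = {}"
      using orbit_eq[OF \<phi>] by blast
  qed (use fin in auto)
  moreover have "(\<Union>X\<in>orbit G \<phi> ` S. X \<inter> B) = B" using orbit_refl[OF \<phi>] B by auto
  ultimately show ?thesis by simp
qed

lemma subgroup_stab:
  assumes \<phi>: "\<phi> \<in> right_actions G S" and s: "s \<in> S"
  shows "subgroup (stab G \<phi> s) G"
proof (rule subgroupI)
  show "stab G \<phi> s \<noteq> {}" using right_action_one[OF \<phi> s] by (auto simp: stab_def)
  show "inv a \<in> stab G \<phi> s" if "a \<in> stab G \<phi> s" for a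
    using that right_action_inv(1)[OF \<phi> _ s, of a] by (auto simp: stab_def)
qed (auto simp: stab_def right_action_mult[OF \<phi> _ _ s])

text \<open>The fibres of the orbit map \<open>g \<mapsto> \<phi> g s\<close> are cosets of the
  stabiliser. Everything about orbits and indices below rests on this.\<close>

lemma stab_coset:
  assumes \<phi>: "\<phi> \<in> right_actions G S" and s: "s \<in> S" and g: "g \<in> carrier G"
  shows "{h \<in> carrier G. \<phi> h s = \<phi> g s} = stab G \<phi> s #> g"
proof (intro equalityI subsetI)
  fix h assume h: "h \<in> {h \<in> carrier G. \<phi> h s = \<phi> g s}"
  then have "\<phi> (h \<otimes> inv g) s = s"
    using right_action_mult[OF \<phi> _ _ s, of h "inv g"] right_action_inv(1)[OF \<phi> g s] g by auto
  then have "h \<otimes> inv g \<in> stab G \<phi> s" "h = h \<otimes> inv g \<otimes> g"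
    using h g by (auto simp: stab_def m_assoc)
  then show "h \<in> stab G \<phi> s #> g" unfolding r_coset_def by blast
next
  fix h assume "h \<in> stab G \<phi> s #> g"
  then show "h \<in> {h \<in> carrier G. \<phi> h s = \<phi> g s}"
    using g right_action_mult[OF \<phi> _ _ s] by (auto simp: r_coset_def stab_def)
qed

text \<open>The bijection of the orbit-stabiliser theorem, from cosets to points. The chosen
  representative does not matter when \<open>C\<close> is a right coset of the stabiliser of
  \<open>s\<close>.\<close>

definition coset_point :: "('a \<Rightarrow> 's \<Rightarrow> 's) \<Rightarrow> 's \<Rightarrow> 'a set \<Rightarrow> 's"
  where "coset_point \<phi> s C = \<phi> (SOME g. g \<in> C) s"

lemma coset_point_eq:
  assumes \<phi>: "\<phi> \<in> right_actions G S" and s: "s \<in> S" and g: "g \<in> carrier G"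
  shows "coset_point \<phi> s (stab G \<phi> s #> g) = \<phi> g s"
proof -
  have "g \<in> stab G \<phi> s #> g" using rcos_self[OF g subgroup_stab[OF \<phi> s]] .
  then have "(SOME h. h \<in> stab G \<phi> s #> g) \<in> stab G \<phi> s #> g" by (rule someI)
  then show ?thesis using stab_coset[OF \<phi> s g] by (auto simp: coset_point_def)
qed

lemma bij_coset_point:
  assumes \<phi>: "\<phi> \<in> right_actions G S" and s: "s \<in> S"
  shows "bij_betw (coset_point \<phi> s) (rcosets (stab G \<phi> s)) (orbit G \<phi> s)"
proof -
  have "inj_on (coset_point \<phi> s) (rcosets (stab G \<phi> s))"
  proof (rule inj_onI)
    fix C D assume "C \<in> rcosets (stab G \<phi> s)" "D \<in> rcosets (stab G \<phi> s)"
      and eq: "coset_point \<phi> s C = coset_point \<phi> s D"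
    then obtain g h where gh: "g \<in> carrier G" "h \<in> carrier G" "C = stab G \<phi> s #> g" "D = stab G \<phi> s #> h"
      by (auto simp: RCOSETS_def)
    then show "C = D" using eq coset_point_eq[OF \<phi> s] stab_coset[OF \<phi> s gh(1)]
        stab_coset[OF \<phi> s gh(2)] by simp
  qed
  moreover have "coset_point \<phi> s ` (rcosets (stab G \<phi> s)) = orbit G \<phi> s"
    unfolding RCOSETS_def orbit_def by (auto simp: coset_point_eq[OF \<phi> s] image_UN)
  ultimately show ?thesis by (simp add: bij_betw_def)
qed

lemma card_rcosets_stab:
  "\<phi> \<in> right_actions G S \<Longrightarrow> s \<in> S \<Longrightarrow> card (rcosets (stab G \<phi> s)) = card (orbit G \<phi> s)"
  by (rule bij_betw_same_card[OF bij_coset_point])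

text \<open>Each point of the orbit is reached by exactly one coset of the stabiliser. Taking for
  \<open>B\<close> the whole orbit gives the orbit-stabiliser theorem; other choices turn a count of
  points into a count of group elements.\<close>

lemma card_action_preimage:
  assumes \<phi>: "\<phi> \<in> right_actions G S" and s: "s \<in> S" and fin: "finite (carrier G)"
    and B: "B \<subseteq> orbit G \<phi> s"
  shows "card {g \<in> carrier G. \<phi> g s \<in> B} = card B * card (stab G \<phi> s)"
proof -
  have fB: "finite B" using B fin finite_subset unfolding orbit_def by blast
  have "card (\<Union>t\<in>B. {g \<in> carrier G. \<phi> g s = t}) = (\<Sum>t\<in>B. card {g \<in> carrier G. \<phi> g s = t})"
    using fB fin by (intro card_UN_disjoint) auto
  also have "\<dots> = (\<Sum>t\<in>B. card (stab G \<phi> s))"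
  proof (rule sum.cong)
    fix t assume "t \<in> B"
    then obtain g where g: "g \<in> carrier G" "t = \<phi> g s" using B by (auto simp: orbit_def)
    then have "{g \<in> carrier G. \<phi> g s = t} \<in> rcosets (stab G \<phi> s)"
      using stab_coset[OF \<phi> s] rcosetsI[OF subgroup.subset[OF subgroup_stab[OF \<phi> s]]] by auto
    then show "card {g \<in> carrier G. \<phi> g s = t} = card (stab G \<phi> s)"
      using card_rcosets_equal[OF _ subgroup.subset[OF subgroup_stab[OF \<phi> s]]] by simp
  qed simp
  also have "(\<Union>t\<in>B. {g \<in> carrier G. \<phi> g s = t}) = {g \<in> carrier G. \<phi> g s \<in> B}" by auto
  finally show ?thesis by simp
qed

lemma card_orbit_stab:
  assumes "\<phi> \<in> right_actions G S" "s \<in> S" "finite (carrier G)"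
  shows "card (orbit G \<phi> s) * card (stab G \<phi> s) = order G"
proof -
  have "{g \<in> carrier G. \<phi> g s \<in> orbit G \<phi> s} = carrier G" by (auto simp: orbit_def)
  then show ?thesis using card_action_preimage[OF assms order_refl] by (simp add: order_def)
qed

lemma coset_action:
  assumes K: "subgroup K G"
  shows "coset_action G K \<in> right_actions G (rcosets K)"
proof -
  have sub: "K \<subseteq> carrier G" using K subgroup.subset by blast
  have C: "C \<subseteq> carrier G" if "C \<in> rcosets K" for C
    using that r_coset_subset_G[OF sub] by (auto simp: RCOSETS_def)
  have cl: "C #> g \<in> rcosets K" if CK: "C \<in> rcosets K" and g: "g \<in> carrier G" for C g
  proof -
    obtain a where "a \<in> carrier G" "C = K #> a" using CK by (auto simp: RCOSETS_def)
    then show ?thesis using coset_mult_assoc[OF sub] g rcosetsI[OF sub] by simp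
  qed
  show ?thesis
    by (rule right_actionsI) (auto simp: coset_action_def cl C coset_mult_assoc)
qed

lemma coset_action_apply:
  assumes "subgroup K G" "g \<in> carrier G"
  shows "coset_action G K g K = K #> g"
  using assms subgroup.subgroup_in_rcosets[OF assms(1) group_axioms] by (simp add: coset_action_def)

lemma stab_coset_action:
  assumes K: "subgroup K G"
  shows "stab G (coset_action G K) K = K"
  using coset_action_apply[OF K] coset_join1[OF _ _ K] coset_join2[OF _ K] subgroup.subset[OF K]
  by (auto simp: stab_def)

lemma orbit_coset_action:
  assumes K: "subgroup K G"
  shows "orbit G (coset_action G K) K = rcosets K"
  using coset_action_apply[OF K] by (auto simp: orbit_def RCOSETS_def)

text \<open>An action is recovered from the map that sends each point to a root of its orbit, and from
  the sets of group elements that carry the root to a given point.  The hypothesis on \<open>t\<close> says that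
  every action in \<open>F\<close> joins \<open>s\<close> to \<open>t s\<close>, so roots can be chosen in the image of \<open>t\<close> and need to
  be specified on that image only.\<close>

lemma card_actions_with_orbits:
  assumes finG: "finite (carrier G)" and finS: "finite S" and F: "F \<subseteq> right_actions G S"
    and t: "\<And>\<phi> s. \<phi> \<in> F \<Longrightarrow> s \<in> S \<Longrightarrow> t s \<in> orbit G \<phi> s"
    and a: "\<And>\<phi>. \<phi> \<in> F \<Longrightarrow> card (orbit G \<phi> ` S) = a"
  shows "card F \<le> (2 ^ (order G + 1)) ^ card S * card S ^ (card (t ` S) - a)"
proof (cases "F = {}")
  case False
  then obtain \<phi>\<^sub>0 where "\<phi>\<^sub>0 \<in> F" by blast
  define T where "T = t ` S"
  have TS: "T \<subseteq> S"
    using t[OF \<open>\<phi>\<^sub>0 \<in> F\<close>] orbit_subset[of \<phi>\<^sub>0 S] F \<open>\<phi>\<^sub>0 \<in> F\<close> unfolding T_def by blast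
  then have finT: "finite T" using finS finite_subset by blast
  \<comment> \<open>The choice depends on the orbit alone, so \<open>root\<close> is constant on
    orbits and fixes every root. It is possible inside \<open>T\<close> because \<open>t s\<close>
    lies in the orbit of \<open>s\<close>.\<close>
  define root where "root \<phi> s = (SOME u. u \<in> T \<inter> orbit G \<phi> s)" for \<phi> s
  have root: "root \<phi> s \<in> T \<inter> orbit G \<phi> s" if "\<phi> \<in> F" "s \<in> S" for \<phi> s
    unfolding root_def by (rule someI[of _ "t s"]) (use t that in \<open>auto simp: T_def\<close>)
  have root_orbit: "root \<phi> s = root \<phi> u" if "orbit G \<phi> s = orbit G \<phi> u" for \<phi> s u
    using that by (simp add: root_def)
  have orb_root: "orbit G \<phi> (root \<phi> s) = orbit G \<phi> s" if "\<phi> \<in> F" "s \<in> S" for \<phi> s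
    using orbit_eq[of \<phi> S s "root \<phi> s"] root[OF that] that F by auto
  have root_t: "root \<phi> (t s) = root \<phi> s" if "\<phi> \<in> F" "s \<in> S" for \<phi> s
    by (rule root_orbit, rule orbit_eq[of \<phi> S]) (use that F t in auto)
  have root_image: "root \<phi> ` T = root \<phi> ` S" if "\<phi> \<in> F" for \<phi>
    using root_t[OF that] TS unfolding T_def by (auto simp: image_iff)
  have card_root: "card (root \<phi> ` T) = a" if "\<phi> \<in> F" for \<phi>
  proof -
    have "bij_betw (orbit G \<phi>) (root \<phi> ` S) (orbit G \<phi> ` S)"
      unfolding bij_betw_def
    proof
      show "inj_on (orbit G \<phi>) (root \<phi> ` S)"
      proof (rule inj_onI, elim imageE, hypsubst)
        fix s u assume "s \<in> S" "u \<in> S" "orbit G \<phi> (root \<phi> s) = orbit G \<phi> (root \<phi> u)"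
        then show "root \<phi> s = root \<phi> u"
          by (intro root_orbit) (simp only: orb_root[OF that])
      qed
      show "orbit G \<phi> ` root \<phi> ` S = orbit G \<phi> ` S"
        using orb_root[OF that] by (simp add: image_image)
    qed
    then have "card (root \<phi> ` S) = card (orbit G \<phi> ` S)" by (rule bij_betw_same_card)
    then show ?thesis by (simp only: root_image[OF that] a[OF that])
  qed
  define lab where "lab \<phi> = (\<lambda>s\<in>S. {g \<in> carrier G. \<phi> g (root \<phi> s) = s})" for \<phi>
  \<comment> \<open>Since \<open>root\<close> fixes each root, the set of roots and the values at
    the other points of \<open>T\<close> determine \<open>root\<close> on \<open>T\<close>, and
    through \<open>t\<close> on all of \<open>S\<close>. Only \<open>card T - a\<close> values are
    recorded, whence the exponent in the bound.\<close>
  define E where "E \<phi> = (root \<phi> ` T, restrict (root \<phi>) (T - root \<phi> ` T), lab \<phi>)" for \<phi>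
  define C where "C = (SIGMA R:{R. R \<subseteq> T \<and> card R = a}. ((T - R) \<rightarrow>\<^sub>E S) \<times> (S \<rightarrow>\<^sub>E Pow (carrier G)))"
  have finC: "finite C"
    unfolding C_def using finT finS finG
    by (intro finite_SigmaI finite_cartesian_product finite_PiE) auto
  have "inj_on E F"
  proof (rule inj_onI)
    fix \<phi> \<psi> assume \<phi>: "\<phi> \<in> F" and \<psi>: "\<psi> \<in> F" and eq: "E \<phi> = E \<psi>"
    have R: "root \<phi> ` T = root \<psi> ` T" using eq by (simp add: E_def)
    have eqT: "root \<phi> u = root \<psi> u" if u: "u \<in> T" for u
    proof (cases "u \<in> root \<phi> ` T")
      case True
      have "root \<theta> u = u" if "\<theta> \<in> F" "u \<in> root \<theta> ` T" for \<theta>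
        using that(2) root_orbit[OF orb_root[OF that(1)]] TS by auto
      then show ?thesis using True R \<phi> \<psi> by simp
    next
      case False
      then show ?thesis using eq u by (auto simp: E_def dest: fun_cong[of _ _ u])
    qed
    have eqS: "root \<phi> s = root \<psi> s" if "s \<in> S" for s
      using eqT[of "t s"] root_t[OF \<phi> that] root_t[OF \<psi> that] that by (simp add: T_def)
    have eql: "\<phi> g (root \<phi> s) = s \<longleftrightarrow> \<psi> g (root \<phi> s) = s" if "s \<in> S" "g \<in> carrier G" for s g
    proof -
      have "lab \<phi> s = lab \<psi> s" using eq by (simp add: E_def)
      then show ?thesis using that eqS by (auto simp: lab_def)
    qed
    have \<phi>A: "\<phi> \<in> right_actions G S" and \<psi>A: "\<psi> \<in> right_actions G S" using \<phi> \<psi> F by auto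
    show "\<phi> = \<psi>"
    proof (rule right_actions_eqI[OF \<phi>A \<psi>A])
      fix g s assume g: "g \<in> carrier G" and s: "s \<in> S"
      define r where "r = root \<phi> s"
      have r: "r \<in> S" "r \<in> orbit G \<phi> s" using root[OF \<phi> s] TS by (auto simp: r_def)
      have "s \<in> orbit G \<phi> r"
        using orbit_eq_iff[OF \<phi>A r(1) s] orb_root[OF \<phi> s] by (simp add: r_def)
      \<comment> \<open>Equal labels transfer this to \<open>\<psi>\<close>: under
        \<open>\<phi>\<close> the root is carried to \<open>s\<close> by \<open>h\<close> and to
        \<open>\<phi> g s\<close> by \<open>h \<otimes> g\<close>, so the same holds under
        \<open>\<psi>\<close>, and \<open>\<psi> g\<close> must send \<open>s\<close> to
        \<open>\<phi> g s\<close>.\<close>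
      then obtain h where h: "h \<in> carrier G" "s = \<phi> h r" by (auto simp: orbit_def)
      have hs: "\<psi> h r = s" using eql[OF s h(1)] h(2)[symmetric] unfolding r_def[symmetric] by blast
      have s': "\<phi> g s \<in> S" using right_action_closed[OF \<phi>A g s] .
      have "root \<phi> (\<phi> g s) = r" unfolding r_def
        by (rule root_orbit, rule orbit_eq[OF \<phi>A s]) (use g in \<open>simp add: orbit_def\<close>)
      moreover have "\<phi> (h \<otimes> g) r = \<phi> g s" using right_action_mult[OF \<phi>A h(1) g r(1)] h(2) by simp
      ultimately have "\<psi> (h \<otimes> g) r = \<phi> g s" using eql[OF s', of "h \<otimes> g"] h(1) g by simp
      then show "\<phi> g s = \<psi> g s" using right_action_mult[OF \<psi>A h(1) g r(1)] hs by simp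
    qed
  qed
  moreover have "E ` F \<subseteq> C"
  proof
    fix z assume "z \<in> E ` F"
    then obtain \<phi> where \<phi>: "\<phi> \<in> F" and z: "z = E \<phi>" by blast
    have "root \<phi> ` T \<subseteq> T" using root[OF \<phi>] TS by blast
    then show "z \<in> C" using card_root[OF \<phi>] TS unfolding z E_def C_def lab_def by auto
  qed
  ultimately have "card F \<le> card C" by (rule card_inj_on_le[OF _ _ finC])
  also have "card C = (\<Sum>R\<in>{R. R \<subseteq> T \<and> card R = a}. card (((T - R) \<rightarrow>\<^sub>E S) \<times> (S \<rightarrow>\<^sub>E Pow (carrier G))))"
    unfolding C_def using finT finS finG by (intro card_SigmaI) (auto intro!: finite_PiE)
  also have "\<dots> = (\<Sum>R\<in>{R. R \<subseteq> T \<and> card R = a}. card S ^ (card T - a) * (2 ^ order G) ^ card S)"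
  proof (rule sum.cong)
    fix R assume "R \<in> {R. R \<subseteq> T \<and> card R = a}"
    then have "card (T - R) = card T - a" "finite (T - R)"
      using finT finite_subset[of R T] by (auto simp: card_Diff_subset)
    then show "card (((T - R) \<rightarrow>\<^sub>E S) \<times> (S \<rightarrow>\<^sub>E Pow (carrier G))) =
        card S ^ (card T - a) * (2 ^ order G) ^ card S"
      using finS finG by (simp add: card_cartesian_product card_funcsetE card_Pow order_def)
  qed simp
  also have "\<dots> = card {R. R \<subseteq> T \<and> card R = a} * (card S ^ (card T - a) * (2 ^ order G) ^ card S)"
    by simp
  \<comment> \<open>The choice of the set of roots is bounded by the number of all subsets, which
    costs only an exponential factor.\<close>
  also have "\<dots> \<le> 2 ^ card S * (card S ^ (card T - a) * (2 ^ order G) ^ card S)"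
  proof (rule mult_right_mono)
    have "card {R. R \<subseteq> T \<and> card R = a} \<le> card (Pow T)" using finT by (intro card_mono) auto
    also have "\<dots> = 2 ^ card T" using finT by (simp add: card_Pow)
    also have "\<dots> \<le> 2 ^ card S" using card_mono[OF finS TS] by (simp add: power_increasing)
    finally show "card {R. R \<subseteq> T \<and> card R = a} \<le> 2 ^ card S" .
  qed simp
  also have "\<dots> = (2 ^ (order G + 1)) ^ card S * card S ^ (card (t ` S) - a)"
    by (simp add: T_def power_mult_distrib)
  finally show ?thesis .
qed simp

lemma restrict_action:
  assumes \<phi>: "\<phi> \<in> right_actions G S" and U: "U \<subseteq> S"
    and inv: "\<And>g s. g \<in> carrier G \<Longrightarrow> s \<in> U \<Longrightarrow> \<phi> g s \<in> U"
  shows "(\<lambda>g\<in>carrier G. \<lambda>s\<in>U. \<phi> g s) \<in> right_actions G U"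
  using inv right_action_one[OF \<phi>] right_action_mult[OF \<phi>] U by (intro right_actionsI) auto

section \<open>Subgroups of finite index as point stabilisers\<close>

lemma bij_from_lessThan:
  assumes "finite X" "card X = k" "x \<in> X"
  shows "\<exists>e. bij_betw e {..<k} X \<and> e 0 = x"
proof -
  have k: "0 < k" using assms card_gt_0_iff by blast
  obtain e where e: "bij_betw e {..<k} X"
    using assms ex_bij_betw_nat_finite lessThan_atLeast0 by metis
  then obtain i where i: "i < k" "e i = x" using assms(3) by (auto simp: bij_betw_def)
  have "bij_betw (e \<circ> Transposition.transpose 0 i) {..<k} X"
    by (rule bij_betw_trans[OF _ e]) (use i k in \<open>auto simp: Transposition.transpose_def intro!: bij_betw_byWitness[where f' = "Transposition.transpose 0 i"]\<close>)
  then show ?thesis using i by (intro exI[of _ "e \<circ> Transposition.transpose 0 i"]) simp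
qed

text \<open>An enumeration that is fixed once and for all for each \<open>K\<close> and starts with
  \<open>K\<close> itself. It allows families of points indexed by cosets to be recorded as
  functions on numbers, independently of the action.\<close>

definition enum_cosets :: "'a set \<Rightarrow> nat \<Rightarrow> 'a set"
  where "enum_cosets K = (SOME e. bij_betw e {..<card (rcosets K)} (rcosets K) \<and> e 0 = K)"

lemma enum_cosets:
  assumes "subgroup K G" "finite (rcosets K)"
  shows "bij_betw (enum_cosets K) {..<card (rcosets K)} (rcosets K)" "enum_cosets K 0 = K"
  using someI_ex[OF bij_from_lessThan[OF assms(2) HOL.refl
      subgroup.subgroup_in_rcosets[OF assms(1) group_axioms]]]
  unfolding enum_cosets_def by auto

text \<open>A subgroup \<open>K\<close> of index \<open>n\<close> together with a relabelling of its
  \<open>n - 1\<close> other cosets gives an action on \<open>{..<n}\<close> with \<open>K\<close>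
  as the stabiliser of \<open>0\<close>. Both can be read off from the action: \<open>K\<close> as
  that stabiliser, the relabelling from the images of \<open>0\<close>.\<close>

lemma subgroups_le_actions:
  assumes fin: "finite (right_actions G {..<n})" and n: "0 < n"
  shows "finite (subgroups_of_index G n)"
    and "num_subgroups G n * fact (n - 1) \<le> card (right_actions G {..<n})"
proof -
  let ?Q = "{\<pi>. \<pi> permutes {1..<n}}"
  define e where "e K = inv_into {..<n} (enum_cosets K)" for K
  have K: "subgroup K G" "finite (rcosets K)" "card (rcosets K) = n" if "K \<in> subgroups_of_index G n" for K
    using that by (auto simp: subgroups_of_index_def)
  have e: "bij_betw (e K) (rcosets K) {..<n}" "e K K = 0" if "K \<in> subgroups_of_index G n" for K
  proof -
    show "bij_betw (e K) (rcosets K) {..<n}"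
      using enum_cosets(1)[OF K(1,2)[OF that]] K(3)[OF that] bij_betw_inv_into unfolding e_def by metis
    have "e K (enum_cosets K 0) = 0"
      unfolding e_def
      by (rule inv_into_f_f)
         (use enum_cosets(1)[OF K(1,2)[OF that]] K(3)[OF that] n in \<open>auto simp: bij_betw_def\<close>)
    then show "e K K = 0" using enum_cosets(2)[OF K(1,2)[OF that]] by simp
  qed
  define F where "F = (\<lambda>(K, \<pi>). transport G (rcosets K) {..<n} (\<pi> \<circ> e K) (coset_action G K))"
  have perm: "bij_betw \<pi> {..<n} {..<n}" "\<pi> 0 = 0" if "\<pi> permutes {1..<n}" for \<pi>
  proof -
    have "\<pi> permutes {..<n}" by (rule permutes_subset[OF that]) auto
    then show "bij_betw \<pi> {..<n} {..<n}" by (rule permutes_imp_bij)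
    show "\<pi> 0 = 0" using permutes_not_in[OF that, of 0] by simp
  qed
  have b: "bij_betw (\<pi> \<circ> e K) (rcosets K) {..<n}"
    if "K \<in> subgroups_of_index G n" "\<pi> permutes {1..<n}" for K \<pi>
    using bij_betw_trans[OF e(1)[OF that(1)] perm(1)[OF that(2)]] .
  have F0: "F (K, \<pi>) g 0 = \<pi> (e K (K #> g))"
    if "K \<in> subgroups_of_index G n" "\<pi> permutes {1..<n}" "g \<in> carrier G" for K \<pi> g
    using transport_apply[OF b[OF that(1,2)] coset_action[OF K(1)[OF that(1)]] that(3)
        subgroup.subgroup_in_rcosets[OF K(1)[OF that(1)] group_axioms]]
      coset_action_apply[OF K(1)[OF that(1)] that(3)] e(2)[OF that(1)] perm(2)[OF that(2)]
    by (simp add: F_def)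
  have stabF: "K = {g \<in> carrier G. F (K, \<pi>) g 0 = 0}"
    if KI: "K \<in> subgroups_of_index G n" and p: "\<pi> permutes {1..<n}" for K \<pi>
  proof -
    have "F (K, \<pi>) g 0 = 0 \<longleftrightarrow> K #> g = K" if g: "g \<in> carrier G" for g
    proof -
      have KK: "K \<in> rcosets K" "K #> g \<in> rcosets K"
        using subgroup.subgroup_in_rcosets[OF K(1)[OF KI] group_axioms]
          rcosetsI[OF subgroup.subset[OF K(1)[OF KI]] g] by auto
      have "(\<pi> \<circ> e K) K = 0" using e(2)[OF KI] perm(2)[OF p] by simp
      then show ?thesis using F0[OF KI p g] b[OF KI p] KK
        unfolding bij_betw_def inj_on_def by (metis comp_apply)
    qed
    moreover have "K #> g = K \<longleftrightarrow> g \<in> K" if "g \<in> carrier G" for g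
      using coset_join1[OF _ that K(1)[OF KI]]
        coset_join2[OF that K(1)[OF KI]] by blast
    ultimately show ?thesis using subgroup.subset[OF K(1)[OF KI]] by auto
  qed
  have inj: "inj_on F (subgroups_of_index G n \<times> ?Q)"
  proof (rule inj_onI, clarify)
    fix K \<pi> L \<sigma>
    assume KL: "K \<in> subgroups_of_index G n" "L \<in> subgroups_of_index G n"
      and p: "\<pi> permutes {1..<n}" "\<sigma> permutes {1..<n}" and eq: "F (K, \<pi>) = F (L, \<sigma>)"
    have KL': "K = L" using stabF[OF KL(1) p(1)] stabF[OF KL(2) p(2)] eq by simp
    have "\<pi> i = \<sigma> i" for i
    proof (cases "i < n")
      case True
      then have "i \<in> e K ` (rcosets K)" using e(1)[OF KL(1)] by (simp add: bij_betw_def)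
      then obtain C where "C \<in> rcosets K" "e K C = i" by blast
      then show ?thesis using F0[OF KL(1) p(1)] F0[OF KL(2) p(2)] KL' eq by (auto simp: RCOSETS_def)
    next
      case False
      then show ?thesis using permutes_not_in[OF p(1)] permutes_not_in[OF p(2)] by simp
    qed
    then show "K = L \<and> \<pi> = \<sigma>" using KL' by auto
  qed
  have sub: "F ` (subgroups_of_index G n \<times> ?Q) \<subseteq> right_actions G {..<n}"
    using transport_action[OF b coset_action[OF K(1)] group_axioms] by (auto simp: F_def)
  have "finite (subgroups_of_index G n \<times> ?Q)" using inj_on_finite[OF inj sub fin] .
  moreover have ne: "?Q \<noteq> {}" using permutes_id by blast
  ultimately show "finite (subgroups_of_index G n)" using finite_cartesian_productD1 by blast
  have "card ?Q = fact (n - 1)" by (rule card_permutations) auto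
  then show "num_subgroups G n * fact (n - 1) \<le> card (right_actions G {..<n})"
    using card_inj_on_le[OF inj sub fin] by (simp add: card_cartesian_product num_subgroups_def)
qed

text \<open>The orbit of a point \<open>s\<^sub>0\<close> is recorded by its stabiliser \<open>K\<close> and by the points that
  correspond to the cosets of \<open>K\<close> other than \<open>K\<close> itself.\<close>

lemma card_right_actions_rec:
  assumes finS: "finite S" and s\<^sub>0: "s\<^sub>0 \<in> S"
    and finA: "\<And>T. T \<subseteq> S \<Longrightarrow> finite (right_actions G T)"
    and finA': "\<And>k. finite (right_actions G {..<k :: nat})"
    and finK: "\<And>k. 0 < k \<Longrightarrow> finite (subgroups_of_index G k)"
  shows "card (right_actions G S) \<le> (\<Sum>k = 1..card S.
    num_subgroups G k * (card S ^ (k - 1) * card (right_actions G {..<card S - k})))"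
proof -
  define st where "st \<phi> = stab G \<phi> s\<^sub>0" for \<phi>
  define ind where "ind \<phi> = card (rcosets (st \<phi>))" for \<phi>
  define y where "y \<phi> = (\<lambda>i\<in>{1..<ind \<phi>}. coset_point \<phi> s\<^sub>0 (enum_cosets (st \<phi>) i))" for \<phi>
  define rest where "rest \<phi> = (\<lambda>g\<in>carrier G. \<lambda>s\<in>S - orbit G \<phi> s\<^sub>0. \<phi> g s)" for \<phi>
  \<comment> \<open>The base point belongs to the coset \<open>K\<close>, so only
    \<open>k - 1\<close> points are free; the factor saved here pays for the sum over
    \<open>k\<close> in \<open>recurrence_bound\<close>. The condition on the cardinality makes the
    complement of the orbit have exactly \<open>card S - k\<close> points.\<close>
  define Y where "Y k = {y \<in> {1..<k} \<rightarrow>\<^sub>E S. card (insert s\<^sub>0 (y ` {1..<k})) = k}" for k :: nat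
  define C where "C = (SIGMA k:{1..card S}. SIGMA K:subgroups_of_index G k. SIGMA y:Y k.
    right_actions G (S - insert s\<^sub>0 (y ` {1..<k})))"
  define E where "E \<phi> = (ind \<phi>, st \<phi>, y \<phi>, rest \<phi>)" for \<phi>
  have finY: "finite (Y k)" for k
    unfolding Y_def using finS finite_PiE[of "{1..<k}" "\<lambda>_. S"] by auto
  have finC: "finite C"
    unfolding C_def using finY finK finA by (intro finite_SigmaI) auto
  have basic: "subgroup (st \<phi>) G" "finite (rcosets (st \<phi>))" "ind \<phi> = card (orbit G \<phi> s\<^sub>0)"
    "orbit G \<phi> s\<^sub>0 \<subseteq> S" "0 < ind \<phi>" if "\<phi> \<in> right_actions G S" for \<phi>
  proof -
    show "subgroup (st \<phi>) G" unfolding st_def by (rule subgroup_stab[OF that s\<^sub>0])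
    show sub: "orbit G \<phi> s\<^sub>0 \<subseteq> S" by (rule orbit_subset[OF that s\<^sub>0])
    then have fin: "finite (orbit G \<phi> s\<^sub>0)" using finS finite_subset by blast
    then show "finite (rcosets (st \<phi>))"
      using bij_betw_finite[OF bij_coset_point[OF that s\<^sub>0]] by (simp add: st_def)
    show ind: "ind \<phi> = card (orbit G \<phi> s\<^sub>0)"
      unfolding ind_def st_def by (rule card_rcosets_stab[OF that s\<^sub>0])
    show "0 < ind \<phi>" using ind fin orbit_refl[OF that s\<^sub>0] card_gt_0_iff by auto
  qed
  have point0: "coset_point \<phi> s\<^sub>0 (st \<phi>) = s\<^sub>0" if "\<phi> \<in> right_actions G S" for \<phi>
    using coset_point_eq[OF that s\<^sub>0 one_closed] right_action_one[OF that s\<^sub>0]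
      subgroup.subset[OF basic(1)[OF that]] by (simp add: st_def)
  have pts: "insert s\<^sub>0 (y \<phi> ` {1..<ind \<phi>}) = orbit G \<phi> s\<^sub>0" if \<phi>: "\<phi> \<in> right_actions G S" for \<phi>
  proof -
    have "{..<ind \<phi>} = insert 0 {1..<ind \<phi>}" using basic(5)[OF \<phi>] by auto
    then have "coset_point \<phi> s\<^sub>0 ` enum_cosets (st \<phi>) ` {..<ind \<phi>} = insert s\<^sub>0 (y \<phi> ` {1..<ind \<phi>})"
      using enum_cosets(2)[OF basic(1,2)[OF \<phi>]] point0[OF \<phi>] by (simp add: y_def image_image)
    then show ?thesis
      using enum_cosets(1)[OF basic(1,2)[OF \<phi>]] bij_coset_point[OF \<phi> s\<^sub>0]
      by (simp add: bij_betw_def ind_def st_def)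
  qed
  have inj: "inj_on E (right_actions G S)"
  proof (rule inj_onI)
    fix \<phi> \<psi> assume \<phi>: "\<phi> \<in> right_actions G S" and \<psi>: "\<psi> \<in> right_actions G S" and eq: "E \<phi> = E \<psi>"
    have st: "st \<phi> = st \<psi>" and ind: "ind \<phi> = ind \<psi>" and y: "y \<phi> = y \<psi>" and rest: "rest \<phi> = rest \<psi>"
      using eq by (auto simp: E_def)
    have orb: "orbit G \<phi> s\<^sub>0 = orbit G \<psi> s\<^sub>0" using pts[OF \<phi>] pts[OF \<psi>] y ind by simp
    have pt: "coset_point \<phi> s\<^sub>0 D = coset_point \<psi> s\<^sub>0 D" if D: "D \<in> rcosets (st \<phi>)" for D
    proof -
      obtain i where i: "i < ind \<phi>" "D = enum_cosets (st \<phi>) i"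
        using enum_cosets(1)[OF basic(1,2)[OF \<phi>]] D by (auto simp: bij_betw_def ind_def)
      show ?thesis
      proof (cases "i = 0")
        case True
        then show ?thesis using i enum_cosets(2)[OF basic(1,2)[OF \<phi>]] point0[OF \<phi>] point0[OF \<psi>] st by simp
      next
        case False
        then show ?thesis using fun_cong[OF y, of i] i ind st by (simp add: y_def)
      qed
    qed
    have gen: "\<phi> g s\<^sub>0 = \<psi> g s\<^sub>0" if "g \<in> carrier G" for g
      using pt[of "st \<phi> #> g"] coset_point_eq[OF \<phi> s\<^sub>0 that] coset_point_eq[OF \<psi> s\<^sub>0 that]
        rcosetsI[OF subgroup.subset[OF basic(1)[OF \<phi>]] that] st by (simp add: st_def)
    show "\<phi> = \<psi>"
    proof (rule right_actions_eqI[OF \<phi> \<psi>])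
      fix g s assume g: "g \<in> carrier G" and s: "s \<in> S"
      show "\<phi> g s = \<psi> g s"
      proof (cases "s \<in> orbit G \<phi> s\<^sub>0")
        case True
        then obtain h where h: "h \<in> carrier G" "s = \<phi> h s\<^sub>0" by (auto simp: orbit_def)
        have "\<phi> g s = \<phi> (h \<otimes> g) s\<^sub>0" "\<psi> g s = \<psi> (h \<otimes> g) s\<^sub>0"
          using h gen[OF h(1)] right_action_mult[OF \<phi> h(1) g s\<^sub>0] right_action_mult[OF \<psi> h(1) g s\<^sub>0]
          by simp_all
        then show ?thesis using gen h(1) g by simp
      next
        case False
        then show ?thesis using fun_cong[OF fun_cong[OF rest, of g], of s] g s orb
          by (simp add: rest_def)
      qed
    qed
  qed
  have sub: "E ` right_actions G S \<subseteq> C"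
  proof (rule image_subsetI)
    fix \<phi> assume \<phi>: "\<phi> \<in> right_actions G S"
    have "ind \<phi> \<in> {1..card S}"
      using basic(3-5)[OF \<phi>] card_mono[OF finS basic(4)[OF \<phi>]] by auto
    moreover have "st \<phi> \<in> subgroups_of_index G (ind \<phi>)"
      using basic(1,2)[OF \<phi>] by (simp add: subgroups_of_index_def ind_def)
    moreover have "y \<phi> \<in> Y (ind \<phi>)"
    proof -
      have "y \<phi> ` {1..<ind \<phi>} \<subseteq> S" using pts[OF \<phi>] basic(4)[OF \<phi>] by blast
      moreover have "y \<phi> \<in> extensional {1..<ind \<phi>}" by (simp add: y_def)
      ultimately show ?thesis unfolding Y_def using pts[OF \<phi>] basic(3)[OF \<phi>] by (auto simp: PiE_def)
    qed
    moreover have "rest \<phi> \<in> right_actions G (S - orbit G \<phi> s\<^sub>0)"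
      unfolding rest_def
    proof (rule restrict_action[OF \<phi>])
      fix g s assume g: "g \<in> carrier G" and s: "s \<in> S - orbit G \<phi> s\<^sub>0"
      have "\<phi> g s \<in> S" using right_action_closed[OF \<phi> g] s by simp
      moreover have "orbit G \<phi> (\<phi> g s) = orbit G \<phi> s"
        by (rule orbit_eq[OF \<phi>]) (use s g in \<open>auto simp: orbit_def\<close>)
      ultimately show "\<phi> g s \<in> S - orbit G \<phi> s\<^sub>0"
        using orbit_eq_iff[OF \<phi> s\<^sub>0] s by auto
    qed auto
    ultimately show "E \<phi> \<in> C" unfolding E_def C_def using pts[OF \<phi>] by auto
  qed
  have "card (right_actions G S) \<le> card C" by (rule card_inj_on_le[OF inj sub finC])
  also have "card C = (\<Sum>k\<in>{1..card S}. \<Sum>K\<in>subgroups_of_index G k. \<Sum>y\<in>Y k.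
      card (right_actions G (S - insert s\<^sub>0 (y ` {1..<k}))))"
    unfolding C_def using finY finK finA
    by (subst card_SigmaI; (auto intro!: finite_SigmaI sum.cong)?)
  also have "\<dots> \<le> (\<Sum>k = 1..card S. num_subgroups G k *
      (card S ^ (k - 1) * card (right_actions G {..<card S - k})))"
  proof (rule sum_mono)
    fix k assume k: "k \<in> {1..card S}"
    have "(\<Sum>K\<in>subgroups_of_index G k. \<Sum>y\<in>Y k.
        card (right_actions G (S - insert s\<^sub>0 (y ` {1..<k})))) \<le>
      (\<Sum>K\<in>subgroups_of_index G k. \<Sum>y\<in>Y k. card (right_actions G {..<card S - k}))"
    proof (intro sum_mono)
      fix y assume "y \<in> Y k"
      then have y: "insert s\<^sub>0 (y ` {1..<k}) \<subseteq> S" "card (insert s\<^sub>0 (y ` {1..<k})) = k"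
        using s\<^sub>0 unfolding Y_def by (auto simp: PiE_def)
      then have "card (S - insert s\<^sub>0 (y ` {1..<k})) = card {..<card S - k}"
        using finS card_Diff_subset[of "insert s\<^sub>0 (y ` {1..<k})" S] finite_subset by simp
      then obtain b where "bij_betw b (S - insert s\<^sub>0 (y ` {1..<k})) {..<card S - k}"
        using finite_same_card_bij finS by (metis finite_Diff finite_lessThan)
      then show "card (right_actions G (S - insert s\<^sub>0 (y ` {1..<k}))) \<le>
          card (right_actions G {..<card S - k})"
        using card_right_actions_le group_axioms finA' by blast
    qed
    also have "\<dots> = num_subgroups G k * (card (Y k) * card (right_actions G {..<card S - k}))"
      by (simp add: num_subgroups_def)
    also have "\<dots> \<le> num_subgroups G k * (card S ^ (k - 1) * card (right_actions G {..<card S - k}))"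
    proof (intro mult_left_mono mult_right_mono)
      have "card (Y k) \<le> card ({1..<k} \<rightarrow>\<^sub>E S)"
        unfolding Y_def using finS by (intro card_mono finite_PiE) auto
      also have "\<dots> = card S ^ (k - 1)" by (simp add: card_funcsetE)
      finally show "card (Y k) \<le> card S ^ (k - 1)" .
    qed auto
    finally show "(\<Sum>K\<in>subgroups_of_index G k. \<Sum>y\<in>Y k.
        card (right_actions G (S - insert s\<^sub>0 (y ` {1..<k})))) \<le>
      num_subgroups G k * (card S ^ (k - 1) * card (right_actions G {..<card S - k}))" .
  qed
  finally show ?thesis .
qed

end

section \<open>Actions of an amalgamated product\<close>

context amalgam
begin

text \<open>The two factors generate \<open>P\<close>, so an action is determined by its
  restrictions to them. Conversely, a word acts by applying its letters in turn, and each defining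
  relation of \<open>R\<close> is respected because the two given actions agree over
  \<open>A\<close>.\<close>

lemma bij_right_actions_amalgam:
  "bij_betw (\<lambda>\<phi>. (\<lambda>y\<in>carrier G. \<phi> (amalg_inl G H A f g y), \<lambda>y\<in>carrier H. \<phi> (amalg_inr G H A f g y)))
    (right_actions P S)
    {(u, v) \<in> right_actions G S \<times> right_actions H S. \<forall>a\<in>carrier A. u (f a) = v (g a)}"
proof -
  interpret P: group P by (rule group_amalgamated_product)
  let ?i = "amalg_inl G H A f g" and ?j = "amalg_inr G H A f g"
  let ?F = "\<lambda>\<phi>. (\<lambda>y\<in>carrier G. \<phi> (?i y), \<lambda>y\<in>carrier H. \<phi> (?j y))"
  have ic: "?i y \<in> carrier P" if "y \<in> carrier G" for y using hom_in_carrier[OF inl_hom that] .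
  have jc: "?j y \<in> carrier P" if "y \<in> carrier H" for y using hom_in_carrier[OF inr_hom that] .
  have fc: "f a \<in> carrier G" "g a \<in> carrier H" if "a \<in> carrier A" for a
    using that f_hom g_hom by (auto intro: hom_in_carrier)
  have ext: "\<phi> X \<in> extensional S" if "\<phi> \<in> right_actions P S" "X \<in> carrier P" for \<phi> X
    using that by (auto simp: right_actions_def PiE_def Pi_def)
  have inj: "inj_on ?F (right_actions P S)"
  proof (rule inj_onI)
    fix \<phi> \<psi> assume \<phi>: "\<phi> \<in> right_actions P S" and \<psi>: "\<psi> \<in> right_actions P S" and eq: "?F \<phi> = ?F \<psi>"
    have "\<phi> (?i y) = \<psi> (?i y)" if "y \<in> carrier G" for y
      using fun_cong[OF arg_cong[OF eq, of fst], of y] that by simp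
    moreover have "\<phi> (?j y) = \<psi> (?j y)" if "y \<in> carrier H" for y
      using fun_cong[OF arg_cong[OF eq, of snd], of y] that by simp
    ultimately have gen: "\<phi> (R `` {[z]}) = \<psi> (R `` {[z]})" if "z \<in> Inl ` carrier G \<union> Inr ` carrier H" for z
      using that by (auto simp: amalg_inl_def amalg_inr_def)
    have words: "\<forall>s\<in>S. \<phi> (R `` {w}) s = \<psi> (R `` {w}) s" if "w \<in> W" for w
      using that unfolding amalg_words_def
    proof (induction w)
      case Nil
      then show ?case using right_action_one[OF \<phi>] right_action_one[OF \<psi>] by (simp add: one_P)
    next
      case (Cons z w)
      have zw: "[z] \<in> W" "w \<in> W" using Cons by (auto simp: amalg_words_def)
      have c: "R `` {z # w} = R `` {[z]} \<otimes>\<^bsub>P\<^esub> R `` {w}" using mult_class[OF zw] by simp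
      show ?case
      proof
        fix s assume s: "s \<in> S"
        have "\<phi> (R `` {z # w}) s = \<phi> (R `` {w}) (\<phi> (R `` {[z]}) s)"
          unfolding c by (rule right_action_mult[OF \<phi> class_in_carrier[OF zw(1)] class_in_carrier[OF zw(2)] s])
        moreover have "\<psi> (R `` {z # w}) s = \<psi> (R `` {w}) (\<psi> (R `` {[z]}) s)"
          unfolding c by (rule right_action_mult[OF \<psi> class_in_carrier[OF zw(1)] class_in_carrier[OF zw(2)] s])
        moreover have "\<psi> (R `` {[z]}) s \<in> S" by (rule right_action_closed[OF \<psi> class_in_carrier[OF zw(1)] s])
        ultimately show "\<phi> (R `` {z # w}) s = \<psi> (R `` {z # w}) s"
          using gen[OF Cons.hyps(1)] Cons.IH by simp
      qed
    qed
    show "\<phi> = \<psi>"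
      by (rule right_actions_eqI[OF \<phi> \<psi>]) (use words in \<open>auto elim: carrier_cases\<close>)
  qed
  have sub: "?F ` right_actions P S \<subseteq>
      {(u, v) \<in> right_actions G S \<times> right_actions H S. \<forall>a\<in>carrier A. u (f a) = v (g a)}"
  proof (rule image_subsetI)
    fix \<phi> assume \<phi>: "\<phi> \<in> right_actions P S"
    have "(\<lambda>y\<in>carrier G. \<phi> (?i y)) \<in> right_actions G S"
      using ic ext[OF \<phi>] right_action_closed[OF \<phi>] right_action_one[OF \<phi>] right_action_mult[OF \<phi>]
        hom_one[OF inl_hom G.group_axioms P.group_axioms] hom_mult[OF inl_hom]
      by (intro right_actionsI) auto
    moreover have "(\<lambda>y\<in>carrier H. \<phi> (?j y)) \<in> right_actions H S"
      using jc ext[OF \<phi>] right_action_closed[OF \<phi>] right_action_one[OF \<phi>] right_action_mult[OF \<phi>]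
        hom_one[OF inr_hom H.group_axioms P.group_axioms] hom_mult[OF inr_hom]
      by (intro right_actionsI) auto
    ultimately show "?F \<phi> \<in> {(u, v) \<in> right_actions G S \<times> right_actions H S. \<forall>a\<in>carrier A. u (f a) = v (g a)}"
      using fc inl_inr_glue by auto
  qed
  have "{(u, v) \<in> right_actions G S \<times> right_actions H S. \<forall>a\<in>carrier A. u (f a) = v (g a)} \<subseteq>
      ?F ` right_actions P S"
  proof (rule subsetI, clarify)
    fix u v assume u: "u \<in> right_actions G S" and v: "v \<in> right_actions H S"
      and uv: "\<forall>a\<in>carrier A. u (f a) = v (g a)"
    \<comment> \<open>For right actions the leftmost letter has to act first, hence
      \<open>fold\<close>.\<close>
    define e where "e w s = fold (case_sum u v) w s" for w s
    have e_simps: "e [] s = s" "e (z # w) s = e w (case_sum u v z s)" for z w s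
      by (simp_all add: e_def)
    have e_app: "e (w @ w') s = e w' (e w s)" for w w' s by (simp add: e_def)
    have e_closed: "e w s \<in> S" if "w \<in> W" "s \<in> S" for w s
      using that unfolding amalg_words_def
      by (induction w arbitrary: s)
         (auto simp: e_simps right_action_closed[OF u] right_action_closed[OF v])
    have e_cong: "\<forall>s\<in>S. e w s = e w' s" if "(w, w') \<in> R" for w w'
      using that
    proof (induction rule: amalg_cong.induct)
      case (append w w' y y')
      then show ?case using e_closed cong_words by (auto simp: e_app)
    qed (auto simp: e_simps uv right_action_one[OF u] right_action_one[OF v]
          right_action_mult[OF u] right_action_mult[OF v])
    \<comment> \<open>By \<open>e_cong\<close> all words of a class act alike on \<open>S\<close>,
      so the choice of a representative is harmless.\<close>
    define \<phi> where "\<phi> = (\<lambda>X\<in>carrier P. \<lambda>s\<in>S. e (SOME w. w \<in> X) s)"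
    have \<phi>: "\<phi> (R `` {w}) s = e w s" if w: "w \<in> W" and s: "s \<in> S" for w s
    proof -
      have "w \<in> R `` {w}" using w amalg_cong.refl by blast
      then have "(SOME w'. w' \<in> R `` {w}) \<in> R `` {w}" by (rule someI)
      then have "(w, SOME w'. w' \<in> R `` {w}) \<in> R" by simp
      from e_cong[OF this] s show ?thesis
        using class_in_carrier[OF w] by (simp add: \<phi>_def)
    qed
    have \<phi>A: "\<phi> \<in> right_actions P S"
    proof (rule right_actionsI)
      fix X s assume "X \<in> carrier P" "s \<in> S"
      then show "\<phi> X s \<in> S" by (elim carrier_cases) (simp add: \<phi> e_closed)
    next
      fix X Y s assume "X \<in> carrier P" "Y \<in> carrier P" "s \<in> S"
      then show "\<phi> (X \<otimes>\<^bsub>P\<^esub> Y) s = \<phi> Y (\<phi> X s)"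
        by (elim carrier_cases) (simp add: mult_class \<phi> append_words e_closed e_app)
    next
      fix s assume "s \<in> S"
      then show "\<phi> \<one>\<^bsub>P\<^esub> s = s" by (simp add: one_P \<phi> nil_word e_simps)
    qed (auto simp: \<phi>_def)
    have "(\<lambda>y\<in>carrier G. \<phi> (?i y)) = u"
    proof (rule right_actions_eqI[OF _ u])
      show "(\<lambda>y\<in>carrier G. \<phi> (?i y)) \<in> right_actions G S" using sub \<phi>A by auto
    qed (simp add: amalg_inl_def \<phi> inl_word e_simps)
    moreover have "(\<lambda>y\<in>carrier H. \<phi> (?j y)) = v"
    proof (rule right_actions_eqI[OF _ v])
      show "(\<lambda>y\<in>carrier H. \<phi> (?j y)) \<in> right_actions H S" using sub \<phi>A by auto
    qed (simp add: amalg_inr_def \<phi> inr_word e_simps)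
    ultimately show "(u, v) \<in> ?F ` right_actions P S" using \<phi>A by (intro image_eqI[of _ _ \<phi>]) simp_all
  qed
  with sub inj show ?thesis by (simp add: bij_betw_def subset_antisym)
qed

end

section \<open>Pairs of elements with the same image\<close>

lemma card_fibre_pairs:
  assumes "finite X"
  shows "card {(u, v) \<in> X \<times> X. r u = r v} = (\<Sum>y\<in>r ` X. (card {u \<in> X. r u = y})\<^sup>2)"
proof -
  have "{(u, v) \<in> X \<times> X. r u = r v} = (\<Union>y\<in>r ` X. {u \<in> X. r u = y} \<times> {u \<in> X. r u = y})" by auto
  also have "card \<dots> = (\<Sum>y\<in>r ` X. card ({u \<in> X. r u = y} \<times> {u \<in> X. r u = y}))"
    using assms by (intro card_UN_disjoint) auto
  finally show ?thesis by (simp add: card_cartesian_product power2_eq_square)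
qed

text \<open>The Cauchy-Schwarz inequality for the sizes of the fibres. It yields many pairs as soon
  as \<open>r\<close> takes few values, without any information on a single fibre.\<close>

lemma card_fibre_pairs_ge:
  assumes "finite X"
  shows "(card X)\<^sup>2 \<le> card (r ` X) * card {(u, v) \<in> X \<times> X. r u = r v}"
proof -
  have "card X = (\<Sum>y\<in>r ` X. card {u \<in> X. r u = y})"
    using sum.image_gen[OF assms, of "\<lambda>_. 1::nat" r] by simp
  then have "(real (card X))\<^sup>2 = (\<Sum>y\<in>r ` X. real (card {u \<in> X. r u = y}))\<^sup>2" by simp
  also have "\<dots> \<le> (\<Sum>y\<in>r ` X. (real (card {u \<in> X. r u = y}))\<^sup>2) * real (card (r ` X))"
    by (rule sum_squared_le_sum_of_squares)
  also have "\<dots> = real (card (r ` X) * card {(u, v) \<in> X \<times> X. r u = r v})"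
    unfolding card_fibre_pairs[OF assms] by simp
  finally show ?thesis unfolding of_nat_power[symmetric] of_nat_le_iff .
qed

section \<open>Fixed points, orbits of a group of prime order, and conjugacy classes\<close>

context group
begin

lemma subgroup_generated_action:
  assumes \<phi>: "\<phi> \<in> right_actions G S"
  shows "restrict \<phi> (carrier (subgroup_generated G X)) \<in> right_actions (subgroup_generated G X) S"
proof -
  interpret A: group "subgroup_generated G X" by simp
  have c: "g \<in> carrier G" if "g \<in> carrier (subgroup_generated G X)" for g
    using that carrier_subgroup_generated_subset by blast
  have "\<phi> g \<in> extensional S" if "g \<in> carrier G" for g
    using that \<phi> by (auto simp: right_actions_def PiE_def Pi_def)
  then show ?thesis
    using c right_action_closed[OF \<phi>] right_action_one[OF \<phi>] right_action_mult[OF \<phi>]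
      A.one_closed A.m_closed
    by (intro right_actionsI) auto
qed

text \<open>Every orbit has \<open>1\<close> or \<open>p\<close> points. An orbit of
  \<open>p\<close> points contributes \<open>p\<close> to the right-hand side, and a fixed point
  contributes \<open>1 + (p - 1)\<close>, which is \<open>p\<close> again.\<close>

lemma card_orbits_prime:
  assumes p: "prime p" "order G = p" and \<phi>: "\<phi> \<in> right_actions G S" and S: "finite S"
  shows "p * card (orbit G \<phi> ` S) = card S + (p - 1) * card {s \<in> S. \<forall>g\<in>carrier G. \<phi> g s = s}"
proof -
  let ?Fix = "{s \<in> S. \<forall>g\<in>carrier G. \<phi> g s = s}"
  have finG: "finite (carrier G)" using p prime_gt_0_nat[of p] by (simp add: order_gt_0_iff_finite[symmetric])
  have "p = card X + (p - 1) * card (X \<inter> ?Fix)" if X: "X \<in> orbit G \<phi> ` S" for X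
  proof -
    obtain s where s: "s \<in> S" "X = orbit G \<phi> s" using X by blast
    have dvd: "card X dvd p" using card_orbit_stab[OF \<phi> s(1) finG] p(2) s(2) by (metis dvd_triv_left)
    show ?thesis
    proof (cases "card X = 1")
      case True
      then have "X = {s}" using orbit_refl[OF \<phi> s(1)] s(2) by (metis card_1_singletonE singletonD)
      moreover have "s \<in> ?Fix" using s \<open>X = {s}\<close> by (auto simp: orbit_def)
      ultimately have "X \<inter> ?Fix = {s}" by blast
      then show ?thesis using True prime_gt_0_nat[OF p(1)] by simp
    next
      case False
      then have Xp: "card X = p" using dvd p(1) by (auto simp: prime_nat_iff)
      have "X \<inter> ?Fix = {}"
      proof (rule ccontr)
        assume "X \<inter> ?Fix \<noteq> {}"
        then obtain t where t: "t \<in> X" "t \<in> ?Fix" by blast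
        then have "orbit G \<phi> t = {t}" using one_closed by (auto simp: orbit_def)
        then show False using orbit_eq[OF \<phi> s(1)] t(1) s(2) False by auto
      qed
      then show ?thesis using Xp by simp
    qed
  qed
  then have "(\<Sum>X\<in>orbit G \<phi> ` S. p) = (\<Sum>X\<in>orbit G \<phi> ` S. card X + (p - 1) * card (X \<inter> ?Fix))"
    by (rule sum.cong[OF HOL.refl])
  also have "\<dots> = (\<Sum>X\<in>orbit G \<phi> ` S. card (X \<inter> S)) + (p - 1) * (\<Sum>X\<in>orbit G \<phi> ` S. card (X \<inter> ?Fix))"
    unfolding sum.distrib sum_distrib_left
    using orbit_subset[OF \<phi>] by (intro arg_cong2[where f = "(+)"] sum.cong) (auto intro!: arg_cong[where f = card])
  also have "\<dots> = card S + (p - 1) * card ?Fix"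
    using sum_card_orbits[OF \<phi> S, of S] sum_card_orbits[OF \<phi> S, of ?Fix] by simp
  finally show ?thesis by (simp add: mult.commute)
qed

lemma conjugation_action:
  "(\<lambda>g\<in>carrier G. \<lambda>y\<in>carrier G. inv g \<otimes> y \<otimes> g) \<in> right_actions G (carrier G)"
  by (rule right_actionsI) (auto simp: m_assoc inv_mult_group)

text \<open>As a right action, conjugation by \<open>g\<close> puts the inverse on the left, whereas
  \<open>conjugacy_class\<close> puts it on the right; the two are matched by inverting
  \<open>g\<close>.\<close>

lemma conjugacy_class_orbit:
  assumes x: "x \<in> carrier G"
  shows "orbit G (\<lambda>g\<in>carrier G. \<lambda>y\<in>carrier G. inv g \<otimes> y \<otimes> g) x = conjugacy_class G x"
proof (intro equalityI subsetI)
  fix y assume "y \<in> orbit G (\<lambda>g\<in>carrier G. \<lambda>y\<in>carrier G. inv g \<otimes> y \<otimes> g) x"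
  then obtain g where "g \<in> carrier G" "y = inv g \<otimes> x \<otimes> inv (inv g)" using x by (auto simp: orbit_def)
  then show "y \<in> conjugacy_class G x" unfolding conjugacy_class_def using inv_closed by blast
next
  fix y assume "y \<in> conjugacy_class G x"
  then obtain g where "g \<in> carrier G" "y = inv (inv g) \<otimes> x \<otimes> inv g" by (auto simp: conjugacy_class_def)
  then show "y \<in> orbit G (\<lambda>g\<in>carrier G. \<lambda>y\<in>carrier G. inv g \<otimes> y \<otimes> g) x"
    unfolding orbit_def using x by (intro image_eqI[of _ _ "inv g"]) auto
qed

text \<open>After inverting \<open>g\<close>, the conjugators form a preimage under the orbit map of
  conjugation. Each element of \<open>[x] \<inter> K\<close> is then hit as often as the centraliser
  of \<open>x\<close> has elements, and the centraliser has order
  \<open>|G| / |[x]|\<close>.\<close>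

lemma card_conjugators:
  assumes x: "x \<in> carrier G" and fin: "finite (carrier G)"
  shows "card {g \<in> carrier G. g \<otimes> x \<otimes> inv g \<in> K} * card (conjugacy_class G x) =
    card (conjugacy_class G x \<inter> K) * order G"
proof -
  define c where "c = (\<lambda>g\<in>carrier G. \<lambda>y\<in>carrier G. inv g \<otimes> y \<otimes> g)"
  have c: "c \<in> right_actions G (carrier G)" unfolding c_def by (rule conjugation_action)
  have orb: "orbit G c x = conjugacy_class G x" unfolding c_def by (rule conjugacy_class_orbit[OF x])
  have "{g \<in> carrier G. g \<otimes> x \<otimes> inv g \<in> K} = m_inv G ` {g \<in> carrier G. c g x \<in> conjugacy_class G x \<inter> K}"
  proof (intro equalityI subsetI)
    fix g assume g: "g \<in> {g \<in> carrier G. g \<otimes> x \<otimes> inv g \<in> K}"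
    then show "g \<in> m_inv G ` {g \<in> carrier G. c g x \<in> conjugacy_class G x \<inter> K}"
      using x by (intro image_eqI[of _ _ "inv g"]) (auto simp: c_def conjugacy_class_def)
  next
    fix g assume "g \<in> m_inv G ` {g \<in> carrier G. c g x \<in> conjugacy_class G x \<inter> K}"
    then show "g \<in> {g \<in> carrier G. g \<otimes> x \<otimes> inv g \<in> K}" using x by (auto simp: c_def)
  qed
  then have "card {g \<in> carrier G. g \<otimes> x \<otimes> inv g \<in> K} =
      card {g \<in> carrier G. c g x \<in> conjugacy_class G x \<inter> K}"
    by (simp add: card_image inj_on_subset[OF inv_inj])
  also have "\<dots> = card (conjugacy_class G x \<inter> K) * card (stab G c x)"
    by (rule card_action_preimage[OF c x fin]) (simp add: orb)
  finally show ?thesis using card_orbit_stab[OF c x fin] by (simp add: orb mult.assoc mult.commute)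
qed

text \<open>The point \<open>\<phi> g s\<close> is fixed by \<open>x\<close> if and only if
  \<open>g \<otimes> x \<otimes> inv g\<close> stabilises \<open>s\<close>, so fixed points are
  counted by conjugators of \<open>x\<close> into the stabiliser. This is the source of the ratio
  \<open>|[x] \<inter> H| / |[x]|\<close> in the formula.\<close>

lemma card_fixed_in_orbit:
  assumes \<phi>: "\<phi> \<in> right_actions G S" and s: "s \<in> S" and x: "x \<in> carrier G" and fin: "finite (carrier G)"
  shows "card (orbit G \<phi> s \<inter> {t \<in> S. \<phi> x t = t}) * card (conjugacy_class G x) =
    card (conjugacy_class G x \<inter> stab G \<phi> s) * card (orbit G \<phi> s)"
proof -
  let ?B = "orbit G \<phi> s \<inter> {t \<in> S. \<phi> x t = t}"
  have "\<phi> g s \<in> ?B \<longleftrightarrow> g \<otimes> x \<otimes> inv g \<in> stab G \<phi> s" if g: "g \<in> carrier G" for g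
  proof -
    have gs: "\<phi> g s \<in> S" "\<phi> x (\<phi> g s) \<in> S"
      using right_action_closed[OF \<phi>] g x s by auto
    have "\<phi> (g \<otimes> x \<otimes> inv g) s = \<phi> (inv g) (\<phi> x (\<phi> g s))"
      using right_action_mult[OF \<phi>] g x s by simp
    then have "\<phi> (g \<otimes> x \<otimes> inv g) s = s \<longleftrightarrow> \<phi> x (\<phi> g s) = \<phi> g s"
      using right_action_inv[OF \<phi> g] s gs by metis
    then show ?thesis using g x gs by (auto simp: stab_def orbit_def)
  qed
  then have "{g \<in> carrier G. \<phi> g s \<in> ?B} = {g \<in> carrier G. g \<otimes> x \<otimes> inv g \<in> stab G \<phi> s}" by blast
  then have "card ?B * card (stab G \<phi> s) * card (conjugacy_class G x) =
      card (conjugacy_class G x \<inter> stab G \<phi> s) * card (orbit G \<phi> s) * card (stab G \<phi> s)"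
    using card_action_preimage[OF \<phi> s fin, of ?B] card_conjugators[OF x fin, of "stab G \<phi> s"]
      card_orbit_stab[OF \<phi> s fin] by simp
  moreover have "card (stab G \<phi> s) \<noteq> 0"
    using card_orbit_stab[OF \<phi> s fin] order_gt_0_iff_finite fin by (metis less_not_refl mult_0_right)
  ultimately show ?thesis by (simp add: mult.assoc mult.left_commute)
qed

end

section \<open>Counting pairs of actions that agree on \<open>x\<close>\<close>

locale prime_order_element = group G for G :: "('a, 'm) monoid_scheme" (structure) +
  fixes x :: 'a and p :: nat
  assumes finite_carrier: "finite (carrier G)" and x_closed: "x \<in> carrier G"
    and prime_p: "prime p" and ord_x: "ord x = p"
begin

abbreviation "A \<equiv> subgroup_generated G {x}"

definition fixed :: "('a \<Rightarrow> 's \<Rightarrow> 's) \<Rightarrow> 's set \<Rightarrow> 's set"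
  where "fixed \<phi> S = {s \<in> S. \<phi> x s = s}"

definition x_orbits :: "('a \<Rightarrow> 's \<Rightarrow> 's) \<Rightarrow> 's set \<Rightarrow> 's set set"
  where "x_orbits \<phi> S = orbit A (restrict \<phi> (carrier A)) ` S"

text \<open>The expression under the maximum in the theorem, with the summand \<open>1 / p\<close>
  included. Its meaning for actions is given by \<open>orbit_rate\<close>.\<close>

definition rate :: "'a set \<Rightarrow> real"
  where "rate K = 1 / real p + (real (card (conjugacy_class G x \<inter> K)) * (real p - 1) /
    (real (card (conjugacy_class G x)) * real p) - 2 / real (card (rcosets K)))"

text \<open>These stand for the actions of the amalgamated product on \<open>S\<close>. Agreement on
  \<open>\<langle>x\<rangle>\<close> is phrased as equality of restrictions, so that the pairs are
  those in a common fibre of the restriction map.\<close>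

definition pairs :: "'s set \<Rightarrow> (('a \<Rightarrow> 's \<Rightarrow> 's) \<times> ('a \<Rightarrow> 's \<Rightarrow> 's)) set"
  where "pairs S = {(u, v) \<in> right_actions G S \<times> right_actions G S.
    restrict u (carrier A) = restrict v (carrier A)}"

sublocale A: group A by simp

lemma A_closed: "g \<in> carrier A \<Longrightarrow> g \<in> carrier G"
  using carrier_subgroup_generated_subset by blast

lemma x_in_A: "x \<in> carrier A"
  using x_closed by (simp add: carrier_subgroup_generated generate.incl)

lemma order_A: "order A = p"
  using generate_pow_card[OF x_closed] ord_x x_closed
  by (simp add: order_def carrier_subgroup_generated)

lemma finite_A: "finite (carrier A)"
  using finite_subset[OF carrier_subgroup_generated_subset finite_carrier] .

lemma p_gt_1: "1 < p"
  using prime_p prime_gt_1_nat by blast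

lemma order_A_le: "order A \<le> order G"
  unfolding order_def by (rule card_mono[OF finite_carrier carrier_subgroup_generated_subset])

text \<open>As \<open>x\<close> generates \<open>A\<close>, the points fixed by \<open>A\<close> are
  those fixed by \<open>x\<close>, and \<open>card_orbits_prime\<close> applies. In particular the
  number of orbits of \<open>\<langle>x\<rangle>\<close> depends only on the numbers of points and
  of fixed points.\<close>

lemma card_x_orbits:
  assumes \<phi>: "\<phi> \<in> right_actions G S" and S: "finite S"
  shows "real (card (x_orbits \<phi> S)) = card S / p + card (fixed \<phi> S) * (real p - 1) / p"
proof -
  have "(\<forall>g\<in>carrier A. restrict \<phi> (carrier A) g s = s) \<longleftrightarrow> \<phi> x s = s" if s: "s \<in> S" for s
  proof
    assume "\<phi> x s = s"
    then have "{x} \<subseteq> stab G \<phi> s" using x_closed by (simp add: stab_def)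
    then have "carrier A \<subseteq> stab G \<phi> s"
      by (rule subgroup_generated_minimal[OF subgroup_stab[OF \<phi> s]])
    then show "\<forall>g\<in>carrier A. restrict \<phi> (carrier A) g s = s" by (auto simp: stab_def)
  qed (use x_in_A in auto)
  then have "{s \<in> S. \<forall>g\<in>carrier A. restrict \<phi> (carrier A) g s = s} = fixed \<phi> S"
    by (auto simp: fixed_def)
  then have "p * card (x_orbits \<phi> S) = card S + (p - 1) * card (fixed \<phi> S)"
    using A.card_orbits_prime[OF prime_p order_A subgroup_generated_action[OF \<phi>] S]
    by (simp add: x_orbits_def)
  then have "real p * card (x_orbits \<phi> S) = card S + (real p - 1) * card (fixed \<phi> S)"
    using p_gt_1 by (metis (mono_tags, lifting) less_imp_le of_nat_1 of_nat_add of_nat_diff of_nat_mult)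
  then show ?thesis using p_gt_1 by (simp add: field_simps)
qed

lemma conjugacy_class_pos: "0 < card (conjugacy_class G x)"
proof -
  have "finite (conjugacy_class G x)" using finite_carrier by (simp add: conjugacy_class_def)
  moreover have "conjugacy_class G x \<noteq> {}" by (auto simp: conjugacy_class_def)
  ultimately show ?thesis by (simp add: card_gt_0_iff)
qed

text \<open>The left-hand side is the number of orbits of \<open>\<langle>x\<rangle>\<close> inside
  a single orbit of \<open>G\<close>, minus \<open>2\<close>. This is the contribution of that orbit
  to \<open>q - 2 * a\<close>, and \<open>rate\<close> is its value per point.\<close>

lemma orbit_rate:
  assumes \<phi>: "\<phi> \<in> right_actions G S" and s: "s \<in> S"
  shows "card (orbit G \<phi> s) / p + card (orbit G \<phi> s \<inter> fixed \<phi> S) * (real p - 1) / p - 2 =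
    card (orbit G \<phi> s) * rate (stab G \<phi> s)"
proof -
  let ?X = "real (card (orbit G \<phi> s))" and ?F = "real (card (orbit G \<phi> s \<inter> fixed \<phi> S))"
    and ?c = "real (card (conjugacy_class G x))"
    and ?k = "real (card (conjugacy_class G x \<inter> stab G \<phi> s))"
  have "finite (orbit G \<phi> s)" using finite_carrier by (simp add: orbit_def)
  then have X: "?X \<noteq> 0" using orbit_refl[OF \<phi> s] by auto
  have "?F * ?c = ?k * ?X"
    using card_fixed_in_orbit[OF \<phi> s x_closed finite_carrier]
    unfolding fixed_def of_nat_mult[symmetric] by simp
  then have F: "?F = ?k * ?X / ?c" using conjugacy_class_pos by (simp add: field_simps)
  show ?thesis
    unfolding rate_def card_rcosets_stab[OF \<phi> s] F
    using X p_gt_1 conjugacy_class_pos by (simp add: field_simps)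
qed

text \<open>Both sides are sums over the orbits of \<open>G\<close>, and \<open>orbit_rate\<close>
  compares them orbit by orbit.\<close>

lemma x_orbits_le:
  fixes \<mu> :: real
  assumes \<phi>: "\<phi> \<in> right_actions G S" and S: "finite S"
    and \<mu>: "\<And>K. subgroup K G \<Longrightarrow> rate K \<le> \<mu>"
  shows "real (card (x_orbits \<phi> S)) - 2 * card (orbit G \<phi> ` S) \<le> \<mu> * card S"
proof -
  let ?O = "orbit G \<phi> ` S"
  have sub: "X \<inter> S = X" if "X \<in> ?O" for X using that orbit_subset[OF \<phi>] by auto
  have "(\<Sum>X\<in>?O. card X) = (\<Sum>X\<in>?O. card (X \<inter> S))" by (rule sum.cong) (simp_all only: sub)
  then have cS: "real (card S) = (\<Sum>X\<in>?O. real (card X))"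
    using sum_card_orbits[OF \<phi> S order_refl] by (simp flip: of_nat_sum)
  have cF: "real (card (fixed \<phi> S)) = (\<Sum>X\<in>?O. real (card (X \<inter> fixed \<phi> S)))"
    using sum_card_orbits[OF \<phi> S, of "fixed \<phi> S"] unfolding of_nat_sum[symmetric] by (simp add: fixed_def)
  have "real (card (x_orbits \<phi> S)) - 2 * card ?O =
      (\<Sum>X\<in>?O. card X / p + card (X \<inter> fixed \<phi> S) * (real p - 1) / p - 2)"
    unfolding card_x_orbits[OF \<phi> S] cS cF
    by (simp add: sum_subtractf sum.distrib sum_divide_distrib sum_distrib_right)
  also have "\<dots> \<le> (\<Sum>X\<in>?O. \<mu> * card X)"
  proof (rule sum_mono)
    fix X assume "X \<in> ?O"
    then obtain s where s: "s \<in> S" "X = orbit G \<phi> s" by blast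
    show "card X / p + card (X \<inter> fixed \<phi> S) * (real p - 1) / p - 2 \<le> \<mu> * card X"
      unfolding s(2) orbit_rate[OF \<phi> s(1)]
      using mult_right_mono[OF \<mu>[OF subgroup_stab[OF \<phi> s(1)]], of "card (orbit G \<phi> s)"]
      by (simp add: mult.commute)
  qed
  also have "\<dots> = \<mu> * card S" unfolding cS by (simp add: sum_distrib_left)
  finally show ?thesis .
qed

text \<open>The base of the exponential factor in \<open>card_actions_with_orbits\<close>. It serves
  for \<open>A\<close> as well, since \<open>A\<close> has at most as many elements as
  \<open>G\<close>.\<close>

definition B :: real where "B = 2 ^ (order G + 1)"

lemma B_ge_1: "1 \<le> B" unfolding B_def by (rule one_le_power) simp

text \<open>The case of \<open>card_actions_with_orbits\<close> in which \<open>t\<close> is the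
  identity: nothing is prescribed, and any point may be a root.\<close>

lemma card_A_actions_le:
  assumes S: "finite S"
  shows "real (card {\<psi> \<in> right_actions A S. card (orbit A \<psi> ` S) = q}) \<le> B ^ card S * real (card S) ^ (card S - q)"
proof -
  have "card {\<psi> \<in> right_actions A S. card (orbit A \<psi> ` S) = q} \<le>
      (2 ^ (order A + 1)) ^ card S * card S ^ (card ((\<lambda>s. s) ` S) - q)"
    by (rule A.card_actions_with_orbits[OF finite_A S]) (auto intro: A.orbit_refl)
  also have "\<dots> \<le> (2 ^ (order G + 1)) ^ card S * card S ^ (card S - q)"
    using order_A_le by (intro mult_mono power_mono) (auto intro: power_increasing)
  finally show ?thesis
    unfolding B_def by (metis (mono_tags, lifting) of_nat_le_iff of_nat_mult of_nat_numeral of_nat_power)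
qed

text \<open>An orbit of \<open>\<psi>\<close> lies within one orbit of the extension, so roots need
  to be named only for one representative of each of the \<open>q\<close> orbits of
  \<open>\<psi>\<close>. An extension with \<open>a\<close> orbits thus costs \<open>n\<close> to
  the power \<open>q - a\<close>, and \<open>q - 2 * a \<le> \<mu> * n\<close> eliminates
  \<open>a\<close>.\<close>

lemma card_extensions_le:
  fixes \<mu> :: real
  assumes S: "finite S" "S \<noteq> {}" and \<psi>: "\<psi> \<in> right_actions A S"
    and \<mu>: "\<And>K. subgroup K G \<Longrightarrow> rate K \<le> \<mu>" "0 \<le> \<mu>"
  shows "real (card {\<phi> \<in> right_actions G S. restrict \<phi> (carrier A) = \<psi>}) \<le>
    (2 * B) ^ card S * card S powr ((\<mu> * card S + card (orbit A \<psi> ` S)) / 2)"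
proof -
  let ?n = "card S" and ?q = "card (orbit A \<psi> ` S)"
  let ?X = "{\<phi> \<in> right_actions G S. restrict \<phi> (carrier A) = \<psi>}"
  let ?F = "\<lambda>a. {\<phi> \<in> ?X. card (orbit G \<phi> ` S) = a}"
  let ?b = "B ^ ?n * ?n powr ((\<mu> * ?n + ?q) / 2)"
  have n: "1 \<le> ?n" using S by (simp add: Suc_le_eq card_gt_0_iff)
  have a_pos: "card (orbit G \<phi> ` S) \<in> {1..?n}" for \<phi>
    using S card_image_le[OF S(1)] by (auto simp: Suc_le_eq card_gt_0_iff)
  \<comment> \<open>The choice depends only on the orbit of \<open>\<psi>\<close>, so
    \<open>t\<close> has at most \<open>q\<close> values.\<close>
  define t where "t s = (SOME u. u \<in> orbit A \<psi> s)" for s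
  have t: "t s \<in> orbit A \<psi> s" if "s \<in> S" for s
    unfolding t_def using A.orbit_refl[OF \<psi> that] by (rule someI)
  have card_t: "card (t ` S) \<le> ?q"
  proof -
    have "t ` S = (\<lambda>X. SOME u. u \<in> X) ` orbit A \<psi> ` S" by (simp add: t_def image_image)
    then show ?thesis using card_image_le[of "orbit A \<psi> ` S"] S by simp
  qed
  have Fa: "real (card (?F a)) \<le> ?b" for a
  proof (cases "?F a = {}")
    case False
    then obtain \<phi> where \<phi>: "\<phi> \<in> ?F a" by blast
    have "card (?F a) \<le> (2 ^ (order G + 1)) ^ ?n * ?n ^ (card (t ` S) - a)"
    proof (rule card_actions_with_orbits[OF finite_carrier S(1)])
      fix \<theta> s assume \<theta>: "\<theta> \<in> ?F a" and s: "s \<in> S"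
      have "orbit A \<psi> s \<subseteq> orbit G \<theta> s" using \<theta> A_closed by (auto simp: orbit_def)
      then show "t s \<in> orbit G \<theta> s" using t[OF s] by blast
    qed auto
    also have "\<dots> \<le> (2 ^ (order G + 1)) ^ ?n * ?n ^ (?q - a)"
      using n card_t by (intro mult_left_mono power_increasing) auto
    finally have le: "real (card (?F a)) \<le> B ^ ?n * real ?n ^ (?q - a)"
      unfolding B_def by (metis (mono_tags, lifting) of_nat_le_iff of_nat_mult of_nat_numeral of_nat_power)
    have "real ?n ^ (?q - a) = ?n powr (?q - a)" using n by (simp add: powr_realpow)
    also have "\<dots> \<le> ?n powr ((\<mu> * ?n + ?q) / 2)"
    proof (rule powr_mono)
      \<comment> \<open>The difference \<open>q - a\<close> is the mean of \<open>q\<close> and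
        \<open>q - 2 * a\<close>. Where the natural subtraction truncates to \<open>0\<close>, the
        bound holds because \<open>\<mu>\<close> is nonnegative.\<close>
      have "real ?q - 2 * a \<le> \<mu> * ?n"
        using x_orbits_le[of \<phi> S \<mu>] \<phi> S(1) \<mu> by (auto simp: x_orbits_def)
      moreover have "0 \<le> \<mu> * ?n" using \<mu>(2) by simp
      ultimately show "real (?q - a) \<le> (\<mu> * ?n + ?q) / 2" by (cases "a \<le> ?q") (auto simp: of_nat_diff)
    qed (use n in simp)
    finally have "real ?n ^ (?q - a) \<le> ?n powr ((\<mu> * ?n + ?q) / 2)" .
    moreover have "0 \<le> B ^ ?n" using B_ge_1 by simp
    ultimately show ?thesis using order_trans[OF le mult_left_mono] by blast
  next
    case True
    show ?thesis unfolding True using B_ge_1 by simp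
  qed
  have finX: "finite ?X" using finite_right_actions[OF finite_carrier S(1)] by auto
  have "real (card ?X) = (\<Sum>a\<in>{1..?n}. real (card (?F a)))"
    using sum.group[OF finX, of "{1..?n}" "\<lambda>\<phi>. card (orbit G \<phi> ` S)" "\<lambda>_. 1::real"]
      image_subsetI[of ?X "\<lambda>\<phi>. card (orbit G \<phi> ` S)" "{1..?n}"] a_pos by simp
  also have "\<dots> \<le> (\<Sum>a\<in>{1..?n}. ?b)" by (intro sum_mono Fa)
  also have "\<dots> = ?n * ?b" by simp
  also have "\<dots> \<le> 2 ^ ?n * ?b"
    using of_nat_less_two_power[of ?n, where 'a = real] B_ge_1 by (intro mult_right_mono) auto
  finally show ?thesis by (simp add: power_mult_distrib)
qed

text \<open>Up to exponential factors, at most \<open>n\<close> to the power \<open>n - q\<close>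
  actions \<open>\<psi>\<close> of \<open>A\<close> have \<open>q\<close> orbits, and at most
  \<open>n\<close> to the power \<open>\<mu> * n + q\<close> pairs lie over each of them. The
  product no longer depends on \<open>q\<close>.\<close>

lemma card_pairs_le:
  fixes \<mu> :: real
  assumes S: "finite S" "S \<noteq> {}" and \<mu>: "\<And>K. subgroup K G \<Longrightarrow> rate K \<le> \<mu>" "0 \<le> \<mu>"
  shows "real (card (pairs S)) \<le> (8 * B ^ 3) ^ card S * card S powr ((1 + \<mu>) * card S)"
proof -
  let ?n = "card S"
  let ?X = "right_actions G S" and ?Y = "right_actions A S"
  let ?r = "\<lambda>\<phi>. restrict \<phi> (carrier A)"
  let ?q = "\<lambda>\<psi>. card (orbit A \<psi> ` S)"
  let ?c = "\<lambda>q. (2 * B) ^ (2 * ?n) * ?n powr (\<mu> * ?n + real q)"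
  have n: "1 \<le> ?n" using S by (simp add: Suc_le_eq card_gt_0_iff)
  have finX: "finite ?X" by (rule finite_right_actions[OF finite_carrier S(1)])
  have finY: "finite ?Y" by (rule finite_right_actions[OF finite_A S(1)])
  have q_pos: "?q \<psi> \<in> {1..?n}" for \<psi>
    using S card_image_le[OF S(1)] by (auto simp: Suc_le_eq card_gt_0_iff)
  have rXY: "?r ` ?X \<subseteq> ?Y" using subgroup_generated_action by blast
  have "real (card (pairs S)) = (\<Sum>\<psi>\<in>?r ` ?X. (real (card {\<phi> \<in> ?X. ?r \<phi> = \<psi>}))\<^sup>2)"
    unfolding pairs_def card_fibre_pairs[OF finX] by simp
  also have "\<dots> \<le> (\<Sum>\<psi>\<in>?Y. (real (card {\<phi> \<in> ?X. ?r \<phi> = \<psi>}))\<^sup>2)"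
    by (rule sum_mono2[OF finY rXY]) simp
  also have "\<dots> \<le> (\<Sum>\<psi>\<in>?Y. ?c (?q \<psi>))"
  proof (rule sum_mono)
    fix \<psi> assume \<psi>: "\<psi> \<in> ?Y"
    have "(real (card {\<phi> \<in> ?X. ?r \<phi> = \<psi>}))\<^sup>2 \<le>
        ((2 * B) ^ ?n * ?n powr ((\<mu> * ?n + ?q \<psi>) / 2))\<^sup>2"
      by (rule power_mono[OF card_extensions_le[OF S \<psi> \<mu>]]) simp_all
    also have "\<dots> = ((2 * B) ^ ?n)\<^sup>2 * (?n powr ((\<mu> * ?n + ?q \<psi>) / 2))\<^sup>2"
      by (rule power_mult_distrib)
    also have "(?n powr ((\<mu> * ?n + ?q \<psi>) / 2))\<^sup>2 = ?n powr (\<mu> * ?n + ?q \<psi>)"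
      by (simp add: power2_eq_square powr_add[symmetric])
    also have "((2 * B) ^ ?n)\<^sup>2 = (2 * B) ^ (2 * ?n)" by (rule power_even_eq[symmetric])
    finally show "(real (card {\<phi> \<in> ?X. ?r \<phi> = \<psi>}))\<^sup>2 \<le> ?c (?q \<psi>)" .
  qed
  also have "\<dots> = (\<Sum>q\<in>{1..?n}. \<Sum>\<psi>\<in>{\<psi> \<in> ?Y. ?q \<psi> = q}. ?c (?q \<psi>))"
    by (rule sum.group[symmetric, OF finY]) (use q_pos in auto)
  also have "\<dots> = (\<Sum>q\<in>{1..?n}. real (card {\<psi> \<in> ?Y. ?q \<psi> = q}) * ?c q)" by simp
  also have "\<dots> \<le> (\<Sum>q\<in>{1..?n}. B ^ ?n * (2 * B) ^ (2 * ?n) * ?n powr ((1 + \<mu>) * ?n))"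
  proof (rule sum_mono)
    fix q assume q: "q \<in> {1..?n}"
    have "real (card {\<psi> \<in> ?Y. ?q \<psi> = q}) * ?c q \<le> B ^ ?n * real ?n ^ (?n - q) * ?c q"
      using B_ge_1 by (intro mult_right_mono card_A_actions_le[OF S(1)]) auto
    also have "real ?n ^ (?n - q) = ?n powr (real ?n - real q)"
      using n q by (simp add: powr_realpow[symmetric] of_nat_diff)
    also have "B ^ ?n * ?n powr (real ?n - real q) * ?c q =
        B ^ ?n * (2 * B) ^ (2 * ?n) * ?n powr ((1 + \<mu>) * ?n)"
      by (simp add: powr_add[symmetric] algebra_simps)
    finally show "real (card {\<psi> \<in> ?Y. ?q \<psi> = q}) * ?c q \<le>
        B ^ ?n * (2 * B) ^ (2 * ?n) * ?n powr ((1 + \<mu>) * ?n)" .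
  qed
  also have "\<dots> = ?n * (B ^ ?n * (2 * B) ^ (2 * ?n) * ?n powr ((1 + \<mu>) * ?n))" by simp
  also have "\<dots> \<le> 2 ^ ?n * (B ^ ?n * (2 * B) ^ (2 * ?n) * ?n powr ((1 + \<mu>) * ?n))"
    using of_nat_less_two_power[of ?n, where 'a = real] B_ge_1 by (intro mult_right_mono) auto
  \<comment> \<open>The base collects \<open>2\<close> for the summation over \<open>q\<close>,
    \<open>B\<close> for the choice of \<open>\<psi>\<close>, and \<open>2 * B\<close> for each of
    its two extensions.\<close>
  also have "\<dots> = (8 * B ^ 3) ^ ?n * ?n powr ((1 + \<mu>) * ?n)"
  proof -
    have "2 ^ ?n * (B ^ ?n * (2 * B) ^ (2 * ?n)) = (2 * (B * (2 * B) ^ 2)) ^ ?n"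
      by (simp only: power_mult_distrib power_mult)
    also have "2 * (B * (2 * B) ^ 2) = 8 * B ^ 3" by (simp add: power2_eq_square power3_eq_cube)
    finally show ?thesis by (simp add: mult.assoc)
  qed
  finally show ?thesis .
qed

end

text \<open>A single term of the exponential series at \<open>n\<close>. This replaces Stirling's
  formula, as an exponential error is harmless.\<close>

lemma power_le_exp_fact: "real n ^ n \<le> exp (real n) * fact n"
proof -
  have "(\<lambda>k. real n ^ k /\<^sub>R fact k) sums exp (real n)" by (rule exp_converges)
  then have "real n ^ n /\<^sub>R fact n \<le> exp (real n)"
    using sum_le_suminf[of "\<lambda>k. real n ^ k /\<^sub>R fact k" "{n}"] by (auto simp: sums_iff)
  then show ?thesis by (simp add: field_simps)
qed

section \<open>Lower bound for the number of pairs\<close>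

context prime_order_element
begin

text \<open>Let \<open>X\<close> consist of all conjugates of the action on \<open>a\<close> copies
  of \<open>G/K\<close>. It has at least \<open>n! / n ^ a\<close> members, and their restrictions
  to \<open>A\<close> all have the same number \<open>q\<close> of orbits, so there are at most
  \<open>B ^ n * n ^ (n - q)\<close> restrictions. The Cauchy-Schwarz inequality then produces the
  pairs.\<close>

lemma card_pairs_ge:
  assumes K: "subgroup K G" and a: "0 < a" and n: "n = a * card (rcosets K)"
  shows "real n powr ((1 + rate K) * n) \<le>
    (B * exp 2) ^ n * card (pairs ({..<a} \<times> (rcosets K)))"
proof -
  define S where "S = {..<a} \<times> (rcosets K)"
  let ?c = "coset_action G K"
  define \<phi>\<^sub>0 where "\<phi>\<^sub>0 = (\<lambda>g\<in>carrier G. \<lambda>s\<in>S. (fst s, ?c g (snd s)))"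
  have fin_rc: "finite (rcosets K)"
    using finite_carrier rcosets_subset_PowG[OF K] finite_subset by blast
  have K_rc: "K \<in> rcosets K" by (rule subgroup.subgroup_in_rcosets[OF K group_axioms])
  have finS: "finite S" and cardS: "card S = n" using fin_rc n by (simp_all add: S_def card_cartesian_product)
  have npos: "0 < n" using a K_rc fin_rc n by (auto simp: card_gt_0_iff)
  have c: "?c \<in> right_actions G (rcosets K)" by (rule coset_action[OF K])
  have \<phi>\<^sub>0: "\<phi>\<^sub>0 \<in> right_actions G S"
    using right_action_closed[OF c] right_action_one[OF c] right_action_mult[OF c]
    by (intro right_actionsI) (auto simp: \<phi>\<^sub>0_def S_def)
  let ?Q = "{\<sigma>. \<sigma> permutes S}"
  define T where "T \<sigma> = transport G S S \<sigma> \<phi>\<^sub>0" for \<sigma>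
  define X where "X = T ` ?Q"
  have bij: "bij_betw \<sigma> S S" if "\<sigma> permutes S" for \<sigma> using permutes_imp_bij[OF that] .
  have T: "T \<sigma> \<in> right_actions G S" if "\<sigma> permutes S" for \<sigma>
    unfolding T_def by (rule transport_action[OF bij[OF that] \<phi>\<^sub>0 group_axioms])
  have T_app: "T \<sigma> g (\<sigma> s) = \<sigma> (\<phi>\<^sub>0 g s)" if "\<sigma> permutes S" "g \<in> carrier G" "s \<in> S" for \<sigma> g s
    unfolding T_def by (rule transport_apply[OF bij[OF that(1)] \<phi>\<^sub>0 that(2,3)])
  have XS: "X \<subseteq> right_actions G S" using T by (auto simp: X_def)
  have finX: "finite X" using finite_subset[OF XS finite_right_actions[OF finite_carrier finS]] .
  have base: "(i, K) \<in> S" if "i < a" for i using that K_rc by (simp add: S_def)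
  \<comment> \<open>A permutation is determined by the conjugated action and by the images of the
    \<open>a\<close> base points \<open>(i, K)\<close>, because each copy of \<open>G/K\<close> is a
    single orbit. Hence at most \<open>n ^ a\<close> permutations give the same action.\<close>
  have card_X: "fact n \<le> card X * n ^ a"
  proof -
    define E where "E \<sigma> = (T \<sigma>, \<lambda>i\<in>{..<a}. \<sigma> (i, K))" for \<sigma>
    have "inj_on E ?Q"
    proof (rule inj_onI, clarify)
      fix \<sigma> \<tau> assume \<sigma>: "\<sigma> permutes S" and \<tau>: "\<tau> permutes S" and eq: "E \<sigma> = E \<tau>"
      show "\<sigma> = \<tau>"
      proof
        fix s show "\<sigma> s = \<tau> s"
        proof (cases "s \<in> S")
          case True
          then obtain i g where ig: "i < a" "g \<in> carrier G" "s = (i, K #> g)"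
            by (auto simp: S_def RCOSETS_def)
          then have s: "s = \<phi>\<^sub>0 g (i, K)"
            using base[OF ig(1)] coset_action_apply[OF K ig(2)] by (simp add: \<phi>\<^sub>0_def)
          have "\<sigma> (i, K) = \<tau> (i, K)"
            using fun_cong[OF arg_cong[OF eq, of snd], of i] ig(1) by (simp add: E_def)
          then show ?thesis
            using T_app[OF \<sigma> ig(2) base[OF ig(1)]] T_app[OF \<tau> ig(2) base[OF ig(1)]] eq
            by (simp add: s E_def)
        qed (use permutes_not_in[OF \<sigma>] permutes_not_in[OF \<tau>] in simp)
      qed
    qed
    moreover have "E ` ?Q \<subseteq> X \<times> ({..<a} \<rightarrow>\<^sub>E S)"
    proof (rule image_subsetI)
      fix \<sigma> assume \<sigma>: "\<sigma> \<in> ?Q"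
      then have "\<sigma> (i, K) \<in> S" if "i < a" for i using permutes_in_image[of \<sigma> S] base[OF that] by blast
      then show "E \<sigma> \<in> X \<times> ({..<a} \<rightarrow>\<^sub>E S)" using \<sigma> by (auto simp: E_def X_def)
    qed
    ultimately have "card ?Q \<le> card (X \<times> ({..<a} \<rightarrow>\<^sub>E S))"
      using finX finS by (intro card_inj_on_le finite_cartesian_product finite_PiE) auto
    then show ?thesis
      using card_permutations[OF cardS finS] by (simp add: card_cartesian_product card_funcsetE cardS)
  qed
  have fixT: "card (fixed (T \<sigma>) S) = a * card (fixed ?c (rcosets K))" if \<sigma>: "\<sigma> permutes S" for \<sigma>
  proof -
    have "fixed (T \<sigma>) S = \<sigma> ` fixed \<phi>\<^sub>0 S"
    proof (intro equalityI subsetI)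
      fix t assume "t \<in> fixed (T \<sigma>) S"
      then have t: "t \<in> S" "T \<sigma> x t = t" by (auto simp: fixed_def)
      then obtain s where s: "s \<in> S" "t = \<sigma> s" using permutes_image[OF \<sigma>] by blast
      then have "\<sigma> (\<phi>\<^sub>0 x s) = \<sigma> s" using t T_app[OF \<sigma> x_closed s(1)] by simp
      then have "\<phi>\<^sub>0 x s = s" using permutes_inj[OF \<sigma>] by (simp add: inj_eq)
      then show "t \<in> \<sigma> ` fixed \<phi>\<^sub>0 S" using s by (auto simp: fixed_def)
    next
      fix t assume "t \<in> \<sigma> ` fixed \<phi>\<^sub>0 S"
      then obtain s where s: "s \<in> S" "\<phi>\<^sub>0 x s = s" "t = \<sigma> s" by (auto simp: fixed_def)
      then show "t \<in> fixed (T \<sigma>) S"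
        using T_app[OF \<sigma> x_closed s(1)] permutes_in_image[OF \<sigma>, of s] by (simp add: fixed_def)
    qed
    then have "card (fixed (T \<sigma>) S) = card (fixed \<phi>\<^sub>0 S)"
      by (simp only: card_image[OF permutes_inj_on[OF \<sigma>]])
    also have "fixed \<phi>\<^sub>0 S = {..<a} \<times> fixed ?c (rcosets K)"
    proof -
      have "\<phi>\<^sub>0 x s = s \<longleftrightarrow> ?c x (snd s) = snd s" if "s \<in> S" for s
        using that x_closed by (simp add: \<phi>\<^sub>0_def prod_eq_iff)
      then have "fixed \<phi>\<^sub>0 S = {s \<in> S. ?c x (snd s) = snd s}" unfolding fixed_def by blast
      also have "\<dots> = {..<a} \<times> fixed ?c (rcosets K)"
        unfolding S_def fixed_def by (simp add: set_eq_iff mem_Times_iff conj_assoc)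
      finally show ?thesis .
    qed
    finally show ?thesis by (simp only: card_cartesian_product card_lessThan)
  qed
  \<comment> \<open>Conjugate actions have equally many fixed points, hence equally many orbits of
    \<open>\<langle>x\<rangle>\<close>, so \<open>T id\<close> can represent all of
    \<open>X\<close>.\<close>
  define q where "q = card (x_orbits (T id) S)"
  have q: "card (x_orbits \<phi> S) = q" if X: "\<phi> \<in> X" for \<phi>
  proof -
    obtain \<sigma> where \<sigma>: "\<sigma> permutes S" "\<phi> = T \<sigma>" using X by (auto simp: X_def)
    have "real (card (x_orbits \<phi> S)) = real q"
      unfolding \<sigma>(2) q_def card_x_orbits[OF T[OF \<sigma>(1)] finS] card_x_orbits[OF T[OF permutes_id] finS]
        fixT[OF \<sigma>(1)] fixT[OF permutes_id] ..
    then show ?thesis by simp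
  qed
  have q_le: "q \<le> n"
    unfolding q_def x_orbits_def using card_image_le[OF finS] cardS by auto
  have q_eq: "real q - 2 * a = n * rate K"
  proof -
    have "card (rcosets K) / p + card (fixed ?c (rcosets K)) * (real p - 1) / p - 2 =
        card (rcosets K) * rate K"
    proof -
      have "rcosets K \<inter> fixed ?c (rcosets K) = fixed ?c (rcosets K)" by (auto simp: fixed_def)
      then show ?thesis
        using orbit_rate[OF c K_rc] by (simp add: orbit_coset_action[OF K] stab_coset_action[OF K])
    qed
    then have "a * (card (rcosets K) / p + card (fixed ?c (rcosets K)) * (real p - 1) / p - 2) =
        n * rate K"
      by (simp add: n)
    moreover have "real q = n / p + a * card (fixed ?c (rcosets K)) * (real p - 1) / p"
      unfolding q_def card_x_orbits[OF T[OF permutes_id] finS] fixT[OF permutes_id] cardS by simp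
    ultimately show ?thesis by (simp add: n algebra_simps)
  qed
  let ?r = "\<lambda>\<phi>. restrict \<phi> (carrier A)"
  have card_r: "real (card (?r ` X)) \<le> B ^ n * real n ^ (n - q)"
  proof -
    have "card (?r ` X) \<le> card {\<psi> \<in> right_actions A S. card (orbit A \<psi> ` S) = q}"
    proof (rule card_mono)
      show "finite {\<psi> \<in> right_actions A S. card (orbit A \<psi> ` S) = q}"
        using finite_right_actions[OF finite_A finS] by simp
      show "?r ` X \<subseteq> {\<psi> \<in> right_actions A S. card (orbit A \<psi> ` S) = q}"
      proof (rule image_subsetI)
        fix \<phi> assume "\<phi> \<in> X"
        then show "?r \<phi> \<in> {\<psi> \<in> right_actions A S. card (orbit A \<psi> ` S) = q}"
          using q[of \<phi>] XS subgroup_generated_action[of \<phi> S "{x}"] unfolding x_orbits_def by blast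
      qed
    qed
    then show ?thesis using card_A_actions_le[OF finS, of q] unfolding cardS by linarith
  qed
  have "card {(u, v) \<in> X \<times> X. ?r u = ?r v} \<le> card (pairs S)"
  proof (rule card_mono)
    show "finite (pairs S)"
      by (rule finite_subset[of _ "right_actions G S \<times> right_actions G S"])
         (auto simp: pairs_def finite_right_actions[OF finite_carrier finS])
  qed (use XS in \<open>auto simp: pairs_def\<close>)
  then have "(card X)\<^sup>2 \<le> card (?r ` X) * card (pairs S)"
    using card_fibre_pairs_ge[OF finX, of ?r] by (meson le_trans mult_le_mono2)
  then have X2: "(real (card X))\<^sup>2 \<le> B ^ n * real n ^ (n - q) * card (pairs S)"
    using mult_right_mono[OF card_r, of "card (pairs S)"]
    by (smt (verit) of_nat_0_le_iff of_nat_le_iff of_nat_mult of_nat_power)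
  \<comment> \<open>The factorial in \<open>card_X\<close> is traded for \<open>n ^ n\<close>;
    squaring makes the error the factor \<open>exp 2 ^ n\<close> of the statement.\<close>
  have "real n ^ n \<le> exp (real n) * (real (card X) * real n ^ a)"
    using power_le_exp_fact[of n] card_X
    by (smt (verit) exp_gt_zero mult_left_mono of_nat_fact of_nat_le_iff of_nat_mult of_nat_power)
  then have "(real n ^ n)\<^sup>2 \<le> (exp (real n) * (real (card X) * real n ^ a))\<^sup>2"
    by (rule power_mono) simp
  also have "\<dots> = exp 2 ^ n * (real n ^ (2 * a) * (real (card X))\<^sup>2)"
    by (simp add: power_mult_distrib exp_of_nat_mult[symmetric] exp_double[symmetric] power_mult[symmetric] mult_ac)
  also have "\<dots> \<le> exp 2 ^ n * (real n ^ (2 * a) * (B ^ n * real n ^ (n - q) * card (pairs S)))"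
    by (intro mult_left_mono X2) auto
  also have "\<dots> = (B * exp 2) ^ n * card (pairs S) * n powr (2 * a + (real n - q))"
  proof -
    have "real n ^ (2 * a) * real n ^ (n - q) = n powr (2 * a + (real n - q))"
      using npos q_le by (simp add: powr_realpow[symmetric] powr_add of_nat_diff)
    then show ?thesis by (simp add: power_mult_distrib mult_ac)
  qed
  also have "(real n ^ n)\<^sup>2 = n powr (2 * n)"
    using powr_realpow[of "real n" "2 * n"] npos by (simp add: power_even_eq)
  finally have "n powr (2 * n) \<le> (B * exp 2) ^ n * card (pairs S) * n powr (2 * a + (real n - q))" .
  then have "n powr (2 * n) / n powr (2 * a + (real n - q)) \<le> (B * exp 2) ^ n * card (pairs S)"
    using npos by (simp add: divide_le_eq)
  \<comment> \<open>The exponent is \<open>2 * n - 2 * a - (n - q) = n + (q - 2 * a)\<close>, and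
    \<open>q - 2 * a\<close> is \<open>n * rate K\<close> by \<open>q_eq\<close>.\<close>
  moreover have "n powr (2 * n) / n powr (2 * a + (real n - q)) = n powr ((1 + rate K) * n)"
    unfolding powr_diff[symmetric] using q_eq by (intro arg_cong[where f = "(powr) (real n)"]) (simp add: algebra_simps)
  ultimately show ?thesis by (simp add: S_def)
qed

end

section \<open>Growth of the number of subgroups\<close>

text \<open>The base of the powers is a fixed \<open>N\<close> instead of \<open>j\<close>, so that
  the powers coming from an orbit of \<open>k\<close> points and from the other \<open>j - k\<close>
  points multiply exactly to the claimed power and the induction closes. The case of interest is
  \<open>j = N\<close>.\<close>

lemma recurrence_bound:
  fixes h s :: "nat \<Rightarrow> nat" and C c :: real and j N :: nat
  assumes h0: "h 0 \<le> 1"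
    and rec: "\<And>n. 0 < n \<Longrightarrow> h n \<le> (\<Sum>k = 1..n. s k * (n ^ (k - 1) * h (n - k)))"
    and s: "\<And>k. 0 < k \<Longrightarrow> real (s k) \<le> C * k powr (c * k)"
    and C: "1 \<le> C" and c: "0 \<le> c" and N: "0 < N"
  shows "j \<le> N \<Longrightarrow> real (h j) \<le> C ^ j * N powr ((1 + c) * j)"
proof (induction j rule: less_induct)
  case (less j)
  show ?case
  proof (cases "j = 0")
    case True
    then show ?thesis using h0 N by simp
  next
    case False
    then have j: "0 < j" by simp
    have "real (h j) \<le> real (\<Sum>k = 1..j. s k * (j ^ (k - 1) * h (j - k)))"
      using rec[OF j] by (simp only: of_nat_le_iff)
    also have "\<dots> = (\<Sum>k = 1..j. real (s k) * (real j ^ (k - 1) * real (h (j - k))))" by simp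
    also have "\<dots> \<le> (\<Sum>k = 1..j. C ^ j * N powr ((1 + c) * j) / j)"
    proof (rule sum_mono)
      fix k assume k: "k \<in> {1..j}"
      have 1: "real (s k) \<le> C * N powr (c * k)"
      proof -
        have "real k powr (c * k) \<le> real N powr (c * k)"
          using k less.prems c by (intro powr_mono2) auto
        then have "C * real k powr (c * k) \<le> C * real N powr (c * k)" using C by (intro mult_left_mono) auto
        then show ?thesis using s[of k] k by auto
      qed
      \<comment> \<open>The exponent \<open>k - 1\<close> leaves a factor \<open>1 / j\<close>,
        which cancels the number of summands.\<close>
      have 2: "real j ^ (k - 1) \<le> N powr k / j"
      proof -
        have "real j ^ (k - 1) * j = real j ^ k" using k by (simp add: power_eq_if)
        also have "\<dots> \<le> real N ^ k" using less.prems by (intro power_mono) auto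
        also have "\<dots> = N powr k" using N by (simp add: powr_realpow)
        finally show ?thesis using j by (simp add: field_simps)
      qed
      have 3: "real (h (j - k)) \<le> C ^ (j - k) * N powr ((1 + c) * (j - k))"
        using less.IH[of "j - k"] k less.prems by auto
      have "real (s k) * (real j ^ (k - 1) * real (h (j - k))) \<le>
          C * N powr (c * k) * (N powr k / j * (C ^ (j - k) * N powr ((1 + c) * (j - k))))"
        using C by (intro mult_mono 1 2 3) auto
      also have "\<dots> = C * C ^ (j - k) * (N powr (c * k) * N powr k * N powr ((1 + c) * (j - k))) / j"
        by simp
      also have "N powr (c * k) * N powr k * N powr ((1 + c) * (j - k)) = N powr ((1 + c) * j)"
        using k unfolding powr_add[symmetric]
        by (intro arg_cong[where f = "(powr) (real N)"]) (simp add: of_nat_diff algebra_simps)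
      also have "C * C ^ (j - k) * N powr ((1 + c) * j) / j \<le> C ^ j * N powr ((1 + c) * j) / j"
      proof (intro divide_right_mono mult_right_mono)
        have "C * C ^ (j - k) = C ^ Suc (j - k)" by simp
        also have "\<dots> \<le> C ^ j" using k C by (intro power_increasing) auto
        finally show "C * C ^ (j - k) \<le> C ^ j" .
      qed auto
      finally show "real (s k) * (real j ^ (k - 1) * real (h (j - k))) \<le> C ^ j * N powr ((1 + c) * j) / j" .
    qed
    also have "\<dots> = C ^ j * N powr ((1 + c) * j)" using j by simp
    finally show ?thesis .
  qed
qed

text \<open>After division by \<open>n * ln n\<close>, the exponential factor leaves only
  \<open>ln D / ln n\<close>, which tends to \<open>0\<close>.\<close>

lemma growth_coefficient_le:
  assumes D: "1 \<le> D"
    and le: "\<And>n. 0 < n \<Longrightarrow> real (num_subgroups G n) \<le> D ^ n * n powr (\<mu> * n)"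
  shows "growth_coefficient G \<le> ereal \<mu>"
proof -
  have "growth_coefficient G \<le> limsup (\<lambda>n. ereal (ln D / ln (real n) + \<mu>))"
    unfolding growth_coefficient_def
  proof (rule Limsup_mono, rule eventually_sequentiallyI[of 2])
    fix n :: nat assume n: "2 \<le> n"
    show "(if num_subgroups G n = 0 then - \<infinity>
      else ereal (ln (real (num_subgroups G n)) / (real n * ln (real n)))) \<le> ereal (ln D / ln (real n) + \<mu>)"
    proof (cases "num_subgroups G n = 0")
      case False
      have "ln (real (num_subgroups G n)) \<le> ln (D ^ n * n powr (\<mu> * n))"
        using False le[of n] n by (intro ln_mono) auto
      also have "\<dots> = n * ln D + \<mu> * n * ln n"
        using D n by (simp add: ln_mult ln_realpow ln_powr)
      also have "\<dots> = (ln D / ln n + \<mu>) * (n * ln n)" using n by (simp add: field_simps)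
      finally have "ln (real (num_subgroups G n)) / (n * ln n) \<le> ln D / ln n + \<mu>"
        using n by (subst pos_divide_le_eq) (auto simp: mult_ac)
      then show ?thesis using False by simp
    qed simp
  qed
  also have "\<dots> = ereal \<mu>"
  proof (rule lim_imp_Limsup)
    have "filterlim (\<lambda>n. ln (real n)) at_top sequentially"
      using filterlim_compose[OF ln_at_top filterlim_real_sequentially] .
    then have "(\<lambda>n. ln D / ln (real n)) \<longlonglongrightarrow> 0"
      by (intro real_tendsto_divide_at_top[OF tendsto_const])
    then have "(\<lambda>n. ln D / ln (real n) + \<mu>) \<longlonglongrightarrow> 0 + \<mu>" by (intro tendsto_intros)
    then show "(\<lambda>n. ereal (ln D / ln (real n) + \<mu>)) \<longlonglongrightarrow> ereal \<mu>" by simp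
  qed simp
  finally show ?thesis .
qed

text \<open>If the upper limit were below \<open>\<mu>\<close>, the subgroup numbers would be at
  most \<open>C * k powr (c * k)\<close> for some \<open>c < \<mu>\<close>. The recurrence would
  pass this rate on to \<open>h\<close>, which contradicts \<open>ge\<close> at a large multiple of
  \<open>m\<close>.\<close>

lemma growth_coefficient_ge:
  fixes h :: "nat \<Rightarrow> nat" and \<mu> Z :: real and m :: nat
  assumes h0: "h 0 \<le> 1"
    and rec: "\<And>n. 0 < n \<Longrightarrow> h n \<le> (\<Sum>k = 1..n. num_subgroups G k * (n ^ (k - 1) * h (n - k)))"
    and \<mu>: "0 < \<mu>" and m: "0 < m" and Z: "1 \<le> Z"
    and ge: "\<And>a. 0 < a \<Longrightarrow> real (a * m) powr ((1 + \<mu>) * real (a * m)) \<le> Z ^ (a * m) * h (a * m)"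
  shows "ereal \<mu> \<le> growth_coefficient G"
proof (rule ccontr)
  assume "\<not> ereal \<mu> \<le> growth_coefficient G"
  then have "growth_coefficient G < ereal \<mu>" by simp
  then obtain c' where c': "growth_coefficient G < ereal c'" "ereal c' < ereal \<mu>"
    using ereal_dense2 by blast
  \<comment> \<open>A nonnegative rate is required by \<open>recurrence_bound\<close>; it can be had
    below \<open>\<mu>\<close> because \<open>\<mu>\<close> is positive.\<close>
  define c where "c = max c' 0"
  have c: "0 \<le> c" "c < \<mu>" "growth_coefficient G < ereal c"
    using c' \<mu> by (auto simp: c_def max_def order.strict_trans2)
  obtain N\<^sub>0 where N\<^sub>0: "\<And>n. N\<^sub>0 \<le> n \<Longrightarrow> (if num_subgroups G n = 0 then - \<infinity>
      else ereal (ln (real (num_subgroups G n)) / (real n * ln (real n)))) < ereal c"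
    using Limsup_lessD[OF c(3)[unfolded growth_coefficient_def]]
    unfolding eventually_sequentially by blast
  define N where "N = max N\<^sub>0 2"
  \<comment> \<open>The sum takes care of the finitely many indices below \<open>N\<close>, where
    the upper limit gives no information. From \<open>N\<close> on, the index is at least
    \<open>2\<close> and its logarithm is positive.\<close>
  define C where "C = 1 + (\<Sum>k<N. real (num_subgroups G k))"
  have C: "1 \<le> C" by (simp add: C_def sum_nonneg)
  have s: "real (num_subgroups G k) \<le> C * k powr (c * k)" if k: "0 < k" for k
  proof (cases "k < N")
    case True
    have "real (num_subgroups G k) \<le> (\<Sum>k<N. real (num_subgroups G k))"
      using True by (intro member_le_sum) auto
    also have "\<dots> \<le> C * 1" by (simp add: C_def)
    also have "\<dots> \<le> C * k powr (c * k)"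
      using C k c by (intro mult_left_mono ge_one_powr_ge_zero) auto
    finally show ?thesis .
  next
    case False
    then have kN: "N\<^sub>0 \<le> k" "2 \<le> k" by (auto simp: N_def)
    have "real (num_subgroups G k) \<le> k powr (c * k)"
    proof (cases "num_subgroups G k = 0")
      case s0: False
      then have "ln (real (num_subgroups G k)) / (k * ln k) < c" using N\<^sub>0[OF kN(1)] by simp
      then have "ln (real (num_subgroups G k)) < c * (k * ln k)"
        using kN(2) by (simp add: pos_divide_less_eq)
      also have "\<dots> = ln (k powr (c * k))" using kN(2) by (simp add: ln_powr)
      finally have "ln (real (num_subgroups G k)) < ln (k powr (c * k))" .
      moreover have "0 < real (num_subgroups G k)" "0 < k powr (c * k)" using s0 kN(2) by auto
      ultimately have "real (num_subgroups G k) < k powr (c * k)" by (simp only: ln_less_cancel_iff)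
      then show ?thesis by simp
    qed simp
    also have "\<dots> \<le> C * k powr (c * k)" using C by (simp add: mult_le_cancel_right1)
    finally show ?thesis .
  qed
  \<comment> \<open>Chosen so that \<open>n powr (\<mu> - c)\<close> exceeds \<open>Z * C\<close>
    for \<open>n = a * m\<close>.\<close>
  define a where "a = nat \<lceil>(Z * C) powr (1 / (\<mu> - c))\<rceil> + 1"
  define n where "n = a * m"
  have a: "0 < a" by (simp add: a_def)
  have n: "0 < n" using a m by (simp add: n_def)
  have ZC: "0 < Z * C" using Z C by simp
  have "n powr ((1 + \<mu>) * n) \<le> Z ^ n * (C ^ n * n powr ((1 + c) * n))"
  proof -
    have "real (h n) \<le> C ^ n * n powr ((1 + c) * n)"
      by (rule recurrence_bound[where s = "num_subgroups G", OF h0 rec s C c(1) n order_refl])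
    then have "Z ^ n * h n \<le> Z ^ n * (C ^ n * n powr ((1 + c) * n))"
      using Z by (intro mult_left_mono) auto
    then show ?thesis using ge[OF a] unfolding n_def by linarith
  qed
  also have "\<dots> = (Z * C) powr n * n powr ((1 + c) * n)"
    using ZC by (simp add: powr_realpow power_mult_distrib)
  finally have "n powr ((1 + \<mu>) * n) / n powr ((1 + c) * n) \<le> (Z * C) powr n"
    using n by (simp add: divide_le_eq)
  also have "n powr ((1 + \<mu>) * n) / n powr ((1 + c) * n) = (n powr (\<mu> - c)) powr n"
    unfolding powr_diff[symmetric] powr_powr by (intro arg_cong[where f = "(powr) (real n)"]) (simp add: algebra_simps)
  finally have "n powr (\<mu> - c) \<le> Z * C"
    using n ZC powr_less_mono2[of "real n" "Z * C" "n powr (\<mu> - c)"] by fastforce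
  moreover have "Z * C < n powr (\<mu> - c)"
  proof -
    have "(Z * C) powr (1 / (\<mu> - c)) < a" unfolding a_def by linarith
    also have "real a \<le> n" unfolding n_def of_nat_le_iff using m by simp
    finally have "((Z * C) powr (1 / (\<mu> - c))) powr (\<mu> - c) < n powr (\<mu> - c)"
      using c(2) by (intro powr_less_mono2) auto
    then show ?thesis using c(2) ZC by (simp add: powr_powr)
  qed
  ultimately show False by simp
qed

section \<open>The growth coefficient of the double of \<open>G\<close> over
  \<open>\<langle>x\<rangle>\<close>\<close>

context prime_order_element
begin

lemma amalgam_double: "amalgam G G A (\<lambda>a. a) (\<lambda>a. a)"
proof -
  have "(\<lambda>a. a) \<in> hom A G" using A_closed by (auto simp: hom_def)
  then show ?thesis by unfold_locales
qed

abbreviation "\<Gamma> \<equiv> amalgamated_product G G A (\<lambda>a. a) (\<lambda>a. a)"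

lemma group_double: "group \<Gamma>"
  by (rule amalgam.group_amalgamated_product[OF amalgam_double])

lemma bij_pairs: "\<exists>b. bij_betw b (right_actions \<Gamma> S) (pairs S)"
proof -
  have "pairs S = {(u, v) \<in> right_actions G S \<times> right_actions G S. \<forall>a\<in>carrier A. u a = v a}"
    unfolding pairs_def by (auto simp: restrict_def fun_eq_iff; metis)
  then show ?thesis using amalgam.bij_right_actions_amalgam[OF amalgam_double] by fastforce
qed

lemma finite_pairs: "finite S \<Longrightarrow> finite (pairs S)"
  by (rule finite_subset[of _ "right_actions G S \<times> right_actions G S"])
     (auto simp: pairs_def finite_right_actions[OF finite_carrier])

lemma finite_double_actions: "finite S \<Longrightarrow> finite (right_actions \<Gamma> S)"
  using bij_pairs[of S] finite_pairs bij_betw_finite by blast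

lemma card_double_actions: "card (right_actions \<Gamma> S) = card (pairs S)"
  using bij_pairs[of S] bij_betw_same_card by blast

text \<open>Each subgroup of index \<open>n\<close> accounts for \<open>(n - 1)!\<close> of the at
  most exponentially many times \<open>n powr ((1 + \<mu>) * n)\<close> pairs. Dividing by this
  factorial removes \<open>n ^ n\<close> up to an exponential factor.\<close>

lemma growth_double_le:
  fixes \<mu> :: real
  assumes \<mu>: "\<And>K. subgroup K G \<Longrightarrow> rate K \<le> \<mu>" "0 \<le> \<mu>"
  shows "growth_coefficient \<Gamma> \<le> ereal \<mu>"
proof (rule growth_coefficient_le)
  interpret D: group \<Gamma> by (rule group_double)
  \<comment> \<open>Here \<open>exp 1\<close> comes from comparing \<open>n ^ n\<close> with
    \<open>n!\<close>, \<open>2\<close> from \<open>n \<le> 2 ^ n\<close> when passing from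
    \<open>n!\<close> to \<open>(n - 1)!\<close>, and the rest from
    \<open>card_pairs_le\<close>.\<close>
  let ?D = "2 * exp 1 * (8 * B ^ 3)"
  have B3: "1 \<le> B ^ 3" using B_ge_1 by simp
  then show "1 \<le> ?D" using exp_ge_add_one_self[of 1] mult_mono[of 1 "2 * exp 1 :: real" 1 "8 * B ^ 3"] by simp
  fix n :: nat assume n: "0 < n"
  let ?s = "real (num_subgroups \<Gamma> n)"
  have "num_subgroups \<Gamma> n * fact (n - 1) \<le> card (pairs {..<n})"
    using D.subgroups_le_actions(2)[OF finite_double_actions n] by (simp add: card_double_actions)
  then have "real (num_subgroups \<Gamma> n * fact (n - 1)) \<le> card (pairs {..<n})" by (simp only: of_nat_le_iff)
  also have "\<dots> \<le> (8 * B ^ 3) ^ n * n powr ((1 + \<mu>) * n)"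
    using card_pairs_le[of "{..<n}" \<mu>] \<mu> n by auto
  finally have 1: "?s * fact (n - 1) \<le> (8 * B ^ 3) ^ n * n powr ((1 + \<mu>) * n)" by simp
  have "?s * real n ^ n \<le> ?s * (exp n * fact n)" by (intro mult_left_mono power_le_exp_fact) simp
  also have "\<dots> = exp n * n * (?s * fact (n - 1))" using n by (simp add: fact_reduce)
  also have "\<dots> \<le> exp n * n * ((8 * B ^ 3) ^ n * n powr ((1 + \<mu>) * n))"
    by (intro mult_left_mono 1) simp
  also have "\<dots> \<le> exp n * 2 ^ n * ((8 * B ^ 3) ^ n * n powr ((1 + \<mu>) * n))"
    using of_nat_less_two_power[of n, where 'a = real] B_ge_1 by (intro mult_right_mono mult_left_mono) auto
  also have "\<dots> = ?D ^ n * n powr (\<mu> * n) * real n ^ n"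
  proof -
    have 1: "n powr ((1 + \<mu>) * n) = n powr (\<mu> * n) * real n ^ n"
      using n by (simp add: powr_realpow[symmetric] powr_add[symmetric] algebra_simps)
    have 2: "exp (real n) = exp 1 ^ n" using exp_of_nat_mult[of n "1::real"] by simp
    have 3: "?D ^ n = 2 ^ n * exp 1 ^ n * (8 * B ^ 3) ^ n" by (simp only: power_mult_distrib)
    show ?thesis unfolding 1 2 3 by (simp only: mult_ac)
  qed
  finally show "?s \<le> ?D ^ n * n powr (\<mu> * n)" using n by simp
qed

text \<open>Copies of \<open>G/K\<close> fill up \<open>n\<close> points only for multiples
  \<open>n\<close> of the index of \<open>K\<close>, so \<open>card_pairs_ge\<close> speaks of such
  \<open>n\<close> alone. This is all that \<open>growth_coefficient_ge\<close> asks for.\<close>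

lemma growth_double_ge:
  assumes K: "subgroup K G" and pos: "0 < rate K"
  shows "ereal (rate K) \<le> growth_coefficient \<Gamma>"
proof -
  interpret D: group \<Gamma> by (rule group_double)
  let ?h = "\<lambda>n. card (right_actions \<Gamma> {..<n::nat})"
  let ?m = "card (rcosets K)"
  have fin_rc: "finite (rcosets K)"
    using finite_carrier rcosets_subset_PowG[OF K] finite_subset by blast
  have K_rc: "K \<in> rcosets K" by (rule subgroup.subgroup_in_rcosets[OF K group_axioms])
  have m: "0 < ?m" using fin_rc K_rc by (auto simp: card_gt_0_iff)
  have Z: "1 \<le> B * exp 2" using B_ge_1 mult_mono[of 1 B 1 "exp 2"] by simp
  have h0: "?h 0 \<le> 1"
    using finite_double_actions[of "{..<0::nat}"] right_actions_eqI[of _ \<Gamma> "{..<0::nat}"]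
    by (simp add: card_le_Suc0_iff_eq)
  have rec: "?h n \<le> (\<Sum>k = 1..n. num_subgroups \<Gamma> k * (n ^ (k - 1) * ?h (n - k)))" if n: "0 < n" for n
  proof -
    have "?h n \<le> (\<Sum>k = 1..card {..<n}. num_subgroups \<Gamma> k * (card {..<n} ^ (k - 1) * ?h (card {..<n} - k)))"
    proof (rule D.card_right_actions_rec[of _ 0])
      show "finite (right_actions \<Gamma> U)" if "U \<subseteq> {..<n}" for U
        using that finite_double_actions finite_subset by blast
      show "finite (subgroups_of_index \<Gamma> k)" if "0 < k" for k
        by (rule D.subgroups_le_actions(1)[OF finite_double_actions that]) simp
    qed (use n finite_double_actions in auto)
    then show ?thesis by simp
  qed
  have ge: "real (a * ?m) powr ((1 + rate K) * real (a * ?m)) \<le> (B * exp 2) ^ (a * ?m) * ?h (a * ?m)"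
    if a: "0 < a" for a
  proof -
    let ?S = "{..<a} \<times> (rcosets K)"
    have "card ?S = card {..<a * ?m}" by (simp add: card_cartesian_product)
    then obtain b where "bij_betw b ?S {..<a * ?m}"
      using finite_same_card_bij[of ?S "{..<a * ?m}"] fin_rc by auto
    then have "card (pairs ?S) \<le> ?h (a * ?m)"
      using card_right_actions_le[OF _ group_double finite_double_actions, of b ?S "{..<a * ?m}"]
      by (simp add: card_double_actions)
    then have "(B * exp 2) ^ (a * ?m) * card (pairs ?S) \<le> (B * exp 2) ^ (a * ?m) * ?h (a * ?m)"
      using B_ge_1 by (intro mult_left_mono) auto
    then show ?thesis using card_pairs_ge[OF K a HOL.refl] by linarith
  qed
  show ?thesis by (rule growth_coefficient_ge[where h = ?h, OF h0 rec pos m Z ge])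
qed

text \<open>No conjugate of \<open>x\<close> is trivial, so the term with the conjugacy class
  vanishes. The value serves to show that the maximum is positive.\<close>

lemma rate_trivial: "rate {\<one>} = 1 / p - 2 / order G"
proof -
  have "x \<noteq> \<one>" using ord_x p_gt_1 by auto
  have "g \<otimes> x \<otimes> inv g \<noteq> \<one>" if g: "g \<in> carrier G" for g
  proof
    assume "g \<otimes> x \<otimes> inv g = \<one>"
    then have "g \<otimes> x = \<one> \<otimes> g" using inv_solve_right'[of \<one> "g \<otimes> x" g] g x_closed by blast
    then show False using g x_closed \<open>x \<noteq> \<one>\<close> by simp
  qed
  then have "conjugacy_class G x \<inter> {\<one>} = {}" unfolding conjugacy_class_def by blast
  moreover have "card (rcosets {\<one>}) = order G"
    using lagrange[OF triv_subgroup] by simp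
  ultimately show ?thesis by (simp add: rate_def)
qed

end

theorem proposition1:
  fixes G :: "('a, 'm) monoid_scheme" and x :: 'a and p :: nat
  assumes "group G" and "finite (carrier G)"
    and "x \<in> carrier G" and "prime p" and "group.ord G x = p"
    and "order G > 2 * p"
  shows "growth_coefficient
      (amalgamated_product G G (subgroup_generated G {x}) (\<lambda>a. a) (\<lambda>a. a)) =
    ereal (1 / real p +
      (MAX H\<in>{H. subgroup H G}.
        real (card (conjugacy_class G x \<inter> H)) * (real p - 1) /
          (real (card (conjugacy_class G x)) * real p)
        - 2 / real (card (rcosets\<^bsub>G\<^esub> H))))"
proof -
  interpret prime_order_element G x p
    using assms by (intro prime_order_element.intro prime_order_element_axioms.intro)
  let ?f = "\<lambda>H. real (card (conjugacy_class G x \<inter> H)) * (real p - 1) /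
      (real (card (conjugacy_class G x)) * real p) - 2 / real (card (rcosets\<^bsub>G\<^esub> H))"
  let ?\<mu> = "1 / real p + (MAX H\<in>{H. subgroup H G}. ?f H)"
  have rate: "rate H = 1 / real p + ?f H" for H by (simp add: rate_def)
  have "{H. subgroup H G} \<subseteq> Pow (carrier G)" using subgroup.subset by blast
  then have fin: "finite {H. subgroup H G}" using assms(2) finite_subset by blast
  have triv: "subgroup {\<one>\<^bsub>G\<^esub>} G" by (rule triv_subgroup)
  have le: "rate H \<le> ?\<mu>" if "subgroup H G" for H
    unfolding rate using fin that by (intro add_left_mono Max_ge) auto
  have "(MAX H\<in>{H. subgroup H G}. ?f H) \<in> ?f ` {H. subgroup H G}"
    by (rule Max_in) (use fin triv in auto)
  then obtain K where MK: "(MAX H\<in>{H. subgroup H G}. ?f H) = ?f K" and "K \<in> {H. subgroup H G}"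
    by (rule imageE)
  then have K: "subgroup K G" "rate K = ?\<mu>" unfolding rate MK by simp_all
  \<comment> \<open>Here \<open>order G > 2 * p\<close> enters: it makes the rate of the trivial
    subgroup positive, and with it \<open>?\<mu>\<close>, as both bounds on the growth
    require.\<close>
  have "2 / real (order G) < 2 / real (2 * p)"
    using assms(6) p_gt_1 by (intro divide_strict_left_mono) simp_all
  then have "0 < rate {\<one>\<^bsub>G\<^esub>}" unfolding rate_trivial by simp
  then have pos: "0 < ?\<mu>" using le[OF triv] by linarith
  show ?thesis
  proof (rule antisym)
    show "growth_coefficient \<Gamma> \<le> ereal ?\<mu>" using le pos by (intro growth_double_le) auto
    show "ereal ?\<mu> \<le> growth_coefficient \<Gamma>" using growth_double_ge[OF K(1)] K(2) pos by simp
  qed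
qed

end
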